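(* For any connected bipartite graph $G\subseteq K_{m,n}$, the $(m+n-2)$-dimensional volume of the root polytope $Q_G$ is expressed in terms of the number of lattice points of the trimmed generalized permutohedron $P_G^-$ as $$\mathrm{Vol}\,Q_G=\frac{\#(P_G^-\cap\mathbb{Z}^n)}{(m+n-2)!}.$$
   Context: $[n]=\{1,\dots,n\}$; $m,n\ge1$. The vertices of $G\subseteq K_{m,n}$ are labeled $1,\dots,m$ (left) and $\bar1,\dots,\bar n$ (right); connectedness is as a graph on all $m+n$ vertices. Let $e_1,\dots,e_m,e_{\bar1},\dots,e_{\bar n}$ be the coordinate vectors in $\mathbb{R}^{m+n}$. The root polytope is $Q_G=\mathrm{ConvexHull}(e_i-e_{\bar j}\mid(i,\bar j)\text{ an edge of }G)\subset\mathbb{R}^{m+n}$. It lies in the $(m+n-2)$-dimensional affine subspace of points whose first $m$ coordinates sum to $1$ and whose last $n$ coordinates sum to $-1$. $\mathrm{Vol}$ is the volume on this subspace normalized so that a parallelepiped spanned by a basis of the lattice of integer vectors parallel to it (integer vectors whose first $m$ coordinates sum to $0$ and whose last $n$ coordinates sum to $0$) has volume $1$; the volume of a point is $1$ when $m=n=1$. Let $I_i=\{j\in[n]\mid(i,\bar j)\in G\}$ for $i=1,\dots,m$, and for nonempty $I\subseteq[n]$ let $\Delta_I\subset\mathbb{R}^n$ be the convex hull of the coordinate vectors indexed by $I$. Let $P_G=\Delta_{I_1}+\cdots+\Delta_{I_m}$ (Minkowski sum) and $P_G^-=\{x\in\mathbb{R}^n\mid x+\Delta_{[n]}\subseteq P_G\}$.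 *)

theory Defs
  imports "HOL-Analysis.Analysis" "HOL-Library.Set_Algebras"
begin

text \<open>
  The numbers \<open>m, n \<ge> 1\<close> are the cardinalities of two finite index types \<open>'m\<close> and \<open>'n\<close>: the left
  vertices are the elements \<open>Inl i\<close> and the right vertices the elements \<open>Inr j\<close> of the sum type
  \<open>'m + 'n\<close>, and \<open>real ^ ('m + 'n)\<close> is the ambient space of the root polytope. A subgraph of the
  complete bipartite graph is given by its edge set \<open>G :: ('m \<times> 'n) set\<close>; it always has all
  \<open>m + n\<close> vertices.
\<close>

definition adjacency :: "('m \<times> 'n) set \<Rightarrow> (('m + 'n) \<times> ('m + 'n)) set" where
  "adjacency G = {(Inl i, Inr j) | i j. (i, j) \<in> G} \<union> {(Inr j, Inl i) | i j. (i, j) \<in> G}"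

definition connected_bipartite :: "('m \<times> 'n) set \<Rightarrow> bool" where
  "connected_bipartite G \<longleftrightarrow> (\<forall>u v. (u, v) \<in> (adjacency G)\<^sup>*)"

definition root_polytope :: "('m::finite \<times> 'n::finite) set \<Rightarrow> (real ^ ('m + 'n)) set" where
  "root_polytope G = convex hull {axis (Inl i) 1 - axis (Inr j) 1 | i j. (i, j) \<in> G}"


subsection \<open>Normalized volume\<close>

definition root_subspace :: "(real ^ ('m::finite + 'n::finite)) set" where
  "root_subspace = {x. (\<Sum>i\<in>UNIV. x $ Inl i) = 1 \<and> (\<Sum>j\<in>UNIV. x $ Inr j) = -1}"

definition root_lattice :: "(real ^ ('m::finite + 'n::finite)) set" where
  "root_lattice = {x. (\<forall>k. x $ k \<in> \<int>) \<and> (\<Sum>i\<in>UNIV. x $ Inl i) = 0 \<and> (\<Sum>j\<in>UNIV. x $ Inr j) = 0}"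

definition lattice_basis :: "'a::real_vector set \<Rightarrow> 'a set \<Rightarrow> bool" where
  "lattice_basis L B \<longleftrightarrow>
     finite B \<and> independent B \<and> L = {\<Sum>b\<in>B. of_int (c b) *\<^sub>R b | c :: 'a \<Rightarrow> int. True}"

text \<open>
  Lebesgue measure in the affine coordinates with origin \<open>p\<close> and axes \<open>B\<close>; the coordinate space is
  the product of one copy of the real line for each \<open>b \<in> B\<close>. The parallelepiped spanned by \<open>B\<close> has
  volume 1. If \<open>B\<close> is empty, the coordinate space is a single point of measure 1.
\<close>
definition coord_volume :: "'a::real_vector \<Rightarrow> 'a set \<Rightarrow> 'a set \<Rightarrow> real" where
  "coord_volume p B S =
     measure (\<Pi>\<^sub>M b\<in>B. lborel) {c \<in> B \<rightarrow>\<^sub>E UNIV. p + (\<Sum>b\<in>B. c b *\<^sub>R b) \<in> S}"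

text \<open>
  The choice of the origin and of the lattice basis is immaterial: two choices differ by a
  translation and a unimodular change of coordinates. Both exist; see \<open>root_subspace_nonempty\<close> and
  \<open>lattice_basis_exists\<close> below.
\<close>
definition root_volume :: "(real ^ ('m::finite + 'n::finite)) set \<Rightarrow> real" where
  "root_volume S = coord_volume (SOME p. p \<in> root_subspace) (SOME B. lattice_basis root_lattice B) S"


subsection \<open>Trimmed generalized permutohedra\<close>

definition nbrs :: "('m \<times> 'n) set \<Rightarrow> 'm \<Rightarrow> 'n set" where
  "nbrs G i = {j. (i, j) \<in> G}"

definition coord_simplex :: "'n::finite set \<Rightarrow> (real ^ 'n) set" where
  "coord_simplex I = convex hull ((\<lambda>j. axis j 1) ` I)"

text \<open>The sum below is the iterated Minkowski sum of sets.\<close>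
definition gen_permutohedron :: "('m::finite \<times> 'n::finite) set \<Rightarrow> (real ^ 'n) set" where
  "gen_permutohedron G = (\<Sum>i\<in>UNIV. coord_simplex (nbrs G i))"

definition trimmed_permutohedron :: "('m::finite \<times> 'n::finite) set \<Rightarrow> (real ^ 'n) set" where
  "trimmed_permutohedron G = {x. x +o coord_simplex UNIV \<subseteq> gen_permutohedron G}"

definition lattice_points :: "(real ^ 'n) set \<Rightarrow> (real ^ 'n) set" where
  "lattice_points S = {x \<in> S. \<forall>j. x $ j \<in> \<int>}"


subsection \<open>Existence of an origin and of a lattice basis\<close>

lemma sum_axis: "(\<Sum>j\<in>UNIV. axis k (1::real) $ f j) = (if k \<in> range f then 1 else 0)"
  if "inj f" for f :: "'b::finite \<Rightarrow> 'c::finite"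
proof (cases "k \<in> range f")
  case True
  then obtain j0 where "k = f j0" by blast
  then have "axis k (1::real) $ f j = (if j = j0 then 1 else 0)" for j
    using that by (auto simp: axis_def inj_eq)
  then show ?thesis using True by simp
next
  case False
  then have "axis k (1::real) $ f j = 0" for j by (auto simp: axis_def)
  then show ?thesis using False by simp
qed

lemma root_subspace_nonempty:
  "\<exists>p :: real ^ ('m::finite + 'n::finite). p \<in> root_subspace"
proof
  show "axis (Inl undefined) 1 - axis (Inr undefined) 1 \<in> (root_subspace :: (real ^ ('m + 'n)) set)"
    by (simp add: root_subspace_def sum_subtractf sum_axis image_iff)
qed

lemma root_polytope_subset: "root_polytope G \<subseteq> root_subspace"
  unfolding root_polytope_def
proof (rule hull_minimal)
  show "{axis (Inl i) 1 - axis (Inr j) 1 | i j. (i, j) \<in> G} \<subseteq> root_subspace"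
    by (auto simp: root_subspace_def sum_subtractf sum_axis image_iff)
  show "convex root_subspace"
    by (auto simp: convex_def root_subspace_def sum.distrib simp flip: sum_distrib_left)
qed

lemma lattice_basis_exists:
  "\<exists>B :: (real ^ ('m::finite + 'n::finite)) set. lattice_basis root_lattice B"
proof -
  define r :: "'m + 'n \<Rightarrow> 'm + 'n" where
    "r k = (case k of Inl _ \<Rightarrow> Inl undefined | Inr _ \<Rightarrow> Inr undefined)" for k
  define K where "K = {k. r k \<noteq> k}"
  define g :: "'m + 'n \<Rightarrow> real ^ ('m + 'n)" where "g k = axis k 1 - axis (r k) 1" for k
  have rK: "r k \<notin> K" for k by (auto simp: K_def r_def split: sum.splits)
  have coord: "(\<Sum>k\<in>K. u k *\<^sub>R g k) $ l = u l" if "l \<in> K" for u l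
  proof -
    have "(\<Sum>k\<in>K. u k *\<^sub>R g k) $ l = (\<Sum>k\<in>K. if k = l then u k else 0)"
      unfolding sum_component using that rK by (intro sum.cong) (auto simp: g_def axis_def)
    then show ?thesis using that by simp
  qed
  have inj: "inj_on g K"
    using rK by (auto simp: inj_on_def g_def vec_eq_iff axis_def) metis
  have sum_g: "(\<Sum>b\<in>g ` K. c b *\<^sub>R b) = (\<Sum>k\<in>K. c (g k) *\<^sub>R g k)" for c
    using inj by (simp add: sum.reindex)
  have indep: "independent (g ` K)"
  proof (rule independent_if_scalars_zero)
    fix c b assume "(\<Sum>b\<in>g ` K. c b *\<^sub>R b) = 0" and "b \<in> g ` K"
    then show "c b = 0"
      using coord[of _ "\<lambda>k. c (g k)"] unfolding sum_g by auto
  qed simp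
  have sums: "(\<Sum>i\<in>UNIV. g k $ Inl i) = 0" "(\<Sum>j\<in>UNIV. g k $ Inr j) = 0" for k
    by (auto simp: g_def r_def sum_subtractf sum_axis image_iff split: sum.splits)
  have comb_sums: "(\<Sum>i\<in>UNIV. (\<Sum>k\<in>K. u k *\<^sub>R g k) $ Inl i) = 0"
    "(\<Sum>j\<in>UNIV. (\<Sum>k\<in>K. u k *\<^sub>R g k) $ Inr j) = 0" for u
    unfolding sum_component
    by (subst sum.swap, simp add: sums flip: sum_distrib_left)+
  have comb: "(\<Sum>k\<in>K. of_int (c k) *\<^sub>R g k) \<in> root_lattice" for c
    unfolding root_lattice_def mem_Collect_eq
  proof (intro conjI allI)
    show "(\<Sum>k\<in>K. of_int (c k) *\<^sub>R g k) $ l \<in> \<int>" for l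
      unfolding sum_component by (intro Ints_sum) (auto simp: g_def axis_def)
  qed (rule comb_sums)+
  have expand: "x = (\<Sum>k\<in>K. x $ k *\<^sub>R g k)" if x: "x \<in> root_lattice" for x
  proof -
    define d where "d = x - (\<Sum>k\<in>K. x $ k *\<^sub>R g k)"
    have d0: "d $ l = 0" if "l \<in> K" for l
      using coord[OF that] by (simp add: d_def)
    have dl: "(\<Sum>i\<in>UNIV. d $ Inl i) = 0" and dr: "(\<Sum>j\<in>UNIV. d $ Inr j) = 0"
      using x comb_sums[of "\<lambda>k. x $ k"] unfolding d_def root_lattice_def vector_minus_component
      by (simp_all only: sum_subtractf mem_Collect_eq)
    have "(\<Sum>i\<in>UNIV. d $ Inl i) = d $ Inl undefined"
      using d0 by (subst sum.remove[of _ undefined]) (auto simp: K_def r_def intro!: sum.neutral)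
    moreover have "(\<Sum>j\<in>UNIV. d $ Inr j) = d $ Inr undefined"
      using d0 by (subst sum.remove[of _ undefined]) (auto simp: K_def r_def intro!: sum.neutral)
    ultimately have "d $ l = 0" for l
      using d0[of l] dl dr by (cases "l \<in> K") (auto simp: K_def r_def split: sum.splits)
    then have "d = 0" by (simp add: vec_eq_iff)
    then show ?thesis unfolding d_def by (rule iffD2[OF eq_iff_diff_eq_0])
  qed
  have "root_lattice = {\<Sum>b\<in>g ` K. of_int (c b) *\<^sub>R b | c. True}"
  proof (intro set_eqI iffI)
    fix x :: "real ^ ('m + 'n)" assume x: "x \<in> root_lattice"
    define c where "c b = \<lfloor>x $ inv_into K g b\<rfloor>" for b
    have "of_int (c (g k)) = x $ k" if "k \<in> K" for k
      using x that inj by (auto simp: c_def root_lattice_def)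
    then have "(\<Sum>k\<in>K. x $ k *\<^sub>R g k) = (\<Sum>k\<in>K. of_int (c (g k)) *\<^sub>R g k)"
      by (intro sum.cong) auto
    then have "x = (\<Sum>b\<in>g ` K. of_int (c b) *\<^sub>R b)"
      unfolding sum_g using expand[OF x] by metis
    then show "x \<in> {\<Sum>b\<in>g ` K. of_int (c b) *\<^sub>R b | c. True}" by blast
  next
    fix x :: "real ^ ('m + 'n)" assume "x \<in> {\<Sum>b\<in>g ` K. of_int (c b) *\<^sub>R b | c. True}"
    then obtain c :: "real ^ ('m + 'n) \<Rightarrow> int" where "x = (\<Sum>b\<in>g ` K. of_int (c b) *\<^sub>R b)"
      by blast
    then show "x \<in> root_lattice" unfolding sum_g using comb by metis
  qed
  with indep have "lattice_basis root_lattice (g ` K)"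
    by (simp add: lattice_basis_def)
  then show ?thesis ..
qed

end

theory Submission
  imports Defs
begin

text \<open>
  For a set \<open>W\<close> of vertices let \<open>C\<^sub>W\<close> be the cone of all \<open>z\<close> on \<open>W\<close> with total sum \<open>0\<close> whose
  sum over every up-closed set (containing with a right vertex all its neighbours in \<open>W\<close>) is
  nonnegative, and let \<open>D\<^sub>W\<close> be the set of integer vectors with total sum \<open>1\<close>, equal to \<open>1\<close> on the
  left vertices, whose sum over every nonempty up-closed set is at least \<open>1\<close>. Adding an edge
  \<open>(i, j)\<close> changes both in the same way: up to a null set, the new part of \<open>C\<^sub>W\<close> is the disjoint
  union, over the up-closed sets \<open>S\<close> of the old graph with \<open>j \<in> S\<close> and \<open>i \<in> W - S\<close>, of copies of
  \<open>(0, \<infinity>) \<times> C\<^sub>S \<times> C\<^bsub>W - S\<^esub>\<close>, and the new part of \<open>D\<^sub>W\<close> is the disjoint union of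
  copies of \<open>D\<^sub>S \<times> D\<^bsub>W - S\<^esub>\<close>. Hence by induction on the number of edges the integral over
  \<open>C\<^sub>W\<close> of \<open>exp (- s)\<close>, where \<open>s\<close> is the sum of the left coordinates, is the cardinality of
  \<open>D\<^sub>W\<close>. The same induction shows that \<open>C\<^sub>W\<close> is generated by the edge vectors. Therefore the root
  polytope is the slice \<open>s = 1\<close> of the cone, so that the integral is \<open>(m + n - 2)!\<close> times its
  volume, and the lattice points of the trimmed generalized permutohedron correspond to
  \<open>D\<^sub>W\<close> for the set \<open>W\<close> of all vertices.
\<close>


subsection \<open>Cut cones\<close>

text \<open>These are the subsets of \<open>W\<close> whose indicator pairs nonnegatively with
  \<open>e_a - e_b\<close> for every edge \<open>(a, b)\<close> inside \<open>W\<close>.\<close>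

definition up_closed :: "('v \<times> 'v) set \<Rightarrow> 'v set \<Rightarrow> 'v set \<Rightarrow> bool" where
  "up_closed E W S \<longleftrightarrow> S \<subseteq> W \<and> (\<forall>(a, b)\<in>E. b \<in> S \<longrightarrow> a \<in> W \<longrightarrow> a \<in> S)"

text \<open>Dual description of the cone spanned by the edge vectors;
  \<open>cut_cone_edge_flow\<close> shows that the inequalities suffice. Values outside
  \<open>W\<close> stay free, so one \<open>z\<close> can be tested against several vertex
  sets.\<close>

definition cut_cone :: "('v \<times> 'v) set \<Rightarrow> 'v set \<Rightarrow> ('v \<Rightarrow> real) set" where
  "cut_cone E W = {z. sum z W = 0 \<and> (\<forall>S. up_closed E W S \<longrightarrow> 0 \<le> sum z S)}"

text \<open>
  For \<open>A\<close> the left vertices, \<open>w\<close> encodes the sequence \<open>x\<^sub>j = - w j\<close> on the right vertices: if \<open>W\<close> is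
  the set of all vertices and \<open>N(J)\<close> the set of neighbours of \<open>J\<close>, then the sum condition on the
  smallest up-closed set containing \<open>J\<close> reads \<open>x(J) \<le> card (N(J)) - 1\<close>.
\<close>
definition draconian :: "'v set \<Rightarrow> ('v \<times> 'v) set \<Rightarrow> 'v set \<Rightarrow> ('v \<Rightarrow> int) set" where
  "draconian A E W = {w. (\<forall>k. k \<notin> W \<longrightarrow> w k = 0) \<and> (\<forall>k\<in>A \<inter> W. w k = 1) \<and> sum w W = 1 \<and>
     (\<forall>S. up_closed E W S \<longrightarrow> S \<noteq> {} \<longrightarrow> 1 \<le> sum w S)}"

section \<open>Unions, restrictions and gluings of up-closed sets\<close>

lemma up_closed_subset: "up_closed E W S \<Longrightarrow> S \<subseteq> W"
  by (simp add: up_closed_def)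

lemma up_closed_Un: "up_closed E W S \<Longrightarrow> up_closed E W T \<Longrightarrow> up_closed E W (S \<union> T)"
  by (auto simp: up_closed_def)

lemma up_closed_Int: "up_closed E W S \<Longrightarrow> up_closed E W T \<Longrightarrow> up_closed E W (S \<inter> T)"
  by (auto simp: up_closed_def)

lemma up_closed_insert:
  "up_closed (insert (i, j) E) W S \<longleftrightarrow> up_closed E W S \<and> (j \<in> S \<longrightarrow> i \<in> W \<longrightarrow> i \<in> S)"
  by (auto simp: up_closed_def)

lemma up_closed_insert_trivial:
  assumes "\<not> (i \<in> W \<and> j \<in> W \<and> i \<noteq> j)"
  shows "up_closed (insert (i, j) E) W = up_closed E W"
  using assms by (auto simp: fun_eq_iff up_closed_def)

lemma up_closed_trans: "up_closed E W S \<Longrightarrow> up_closed E S K \<Longrightarrow> up_closed E W K"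
  unfolding up_closed_def by blast

lemma up_closed_restrict: "up_closed E W S \<Longrightarrow> up_closed E W K \<Longrightarrow> up_closed E S (K \<inter> S)"
  unfolding up_closed_def by blast

lemma up_closed_Un_Diff:
  "up_closed E W S \<Longrightarrow> up_closed E (W - S) K \<Longrightarrow> up_closed E W (S \<union> K)"
  unfolding up_closed_def by blast

lemma up_closed_Diff: "up_closed E W K \<Longrightarrow> up_closed E (W - S) (K - S)"
  unfolding up_closed_def by blast

lemma up_closed_empty_edges: "up_closed {} W S \<longleftrightarrow> S \<subseteq> W"
  by (simp add: up_closed_def)

lemma finite_up_closed: "finite W \<Longrightarrow> up_closed E W S \<Longrightarrow> finite S"
  by (meson finite_subset up_closed_subset)

text \<open>The old value at \<open>v\<close> is discarded, so on \<open>W\<close> this is the chart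
  of the hyperplane \<open>sum z W = 0\<close> by the coordinates in \<open>W - {v}\<close>. It also
  corrects the restriction of \<open>z\<close> to a smaller vertex set at a single vertex.\<close>

definition bal :: "'v \<Rightarrow> 'v set \<Rightarrow> ('v \<Rightarrow> real) \<Rightarrow> 'v \<Rightarrow> real" where
  "bal v W z = z(v := - sum z (W - {v}))"

lemma sum_bal:
  assumes "finite W" "v \<in> W" "K \<subseteq> W"
  shows "sum (bal v W z) K = sum z K - (if v \<in> K then sum z W else 0)"
proof (cases "v \<in> K")
  case True
  have "finite K" using assms finite_subset by blast
  then have "sum (bal v W z) K = bal v W z v + sum (bal v W z) (K - {v})"
    using True by (simp add: sum.remove)
  moreover have "sum (bal v W z) (K - {v}) = sum z (K - {v})"
    by (intro sum.cong) (auto simp: bal_def)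
  moreover have "sum z K = z v + sum z (K - {v})" "sum z W = z v + sum z (W - {v})"
    using True assms \<open>finite K\<close> by (simp_all add: sum.remove)
  ultimately show ?thesis using True by (simp add: bal_def)
next
  case False
  have "sum (bal v W z) K = sum z K"
    using False by (intro sum.cong) (auto simp: bal_def)
  then show ?thesis using False by simp
qed

lemma sum_bal_self: "finite W \<Longrightarrow> v \<in> W \<Longrightarrow> sum (bal v W z) W = 0"
  by (simp add: sum_bal)

text \<open>Balancing subtracts the total sum at \<open>v\<close>. This turns membership into
  inequalities for \<open>z\<close> itself, the form in which minimality of a cut is
  available.\<close>

lemma bal_mem_cut_cone_iff:
  assumes "finite W" "v \<in> W"
  shows "bal v W z \<in> cut_cone E W \<longleftrightarrow>
    (\<forall>K. up_closed E W K \<longrightarrow> (if v \<in> K then sum z W else 0) \<le> sum z K)"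
proof -
  have "sum (bal v W z) K = sum z K - (if v \<in> K then sum z W else 0)" if "up_closed E W K" for K
    using sum_bal[OF assms up_closed_subset[OF that]] .
  then show ?thesis
    using sum_bal_self[OF assms] unfolding cut_cone_def by (simp cong: imp_cong)
qed

text \<open>
  The points of the piece are those of the form \<open>t (e\<^sub>i - e\<^sub>j) + z\<^sub>1 + z\<^sub>2\<close> with \<open>t > 0\<close> and
  \<open>z\<^sub>1\<close>, \<open>z\<^sub>2\<close> in the cones of \<open>S\<close> and \<open>W - S\<close>; necessarily \<open>t = - sum z S\<close>.
\<close>
definition cone_piece ::
  "('v \<times> 'v) set \<Rightarrow> 'v set \<Rightarrow> 'v \<Rightarrow> 'v \<Rightarrow> 'v set \<Rightarrow> ('v \<Rightarrow> real) set" where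
  "cone_piece E W i j S = {z. sum z W = 0 \<and> sum z S < 0 \<and>
     bal j S z \<in> cut_cone E S \<and> bal i (W - S) z \<in> cut_cone E (W - S)}"

text \<open>Exactly the up-closed sets destroyed by inserting the edge \<open>(i, j)\<close>; each
  drops one inequality of the cone and so indexes one piece.\<close>

definition separating :: "('v \<times> 'v) set \<Rightarrow> 'v set \<Rightarrow> 'v \<Rightarrow> 'v \<Rightarrow> 'v set set" where
  "separating E W i j = {S. up_closed E W S \<and> j \<in> S \<and> i \<in> W - S}"

lemma finite_separating: "finite W \<Longrightarrow> finite (separating E W i j)"
  by (rule finite_subset[of _ "Pow W"]) (auto simp: separating_def dest: up_closed_subset)

context
  fixes E :: "('v \<times> 'v) set" and W :: "'v set" and i j :: 'v
  assumes W: "finite W"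
begin

text \<open>The cone inequalities for the parts of \<open>K\<close> inside and outside
  \<open>S\<close> add up, with \<open>sum z (W - S) = - sum z S\<close>. Thus \<open>S\<close> is a
  minimiser among all cuts, and every cut surviving the new edge stays nonnegative.\<close>

lemma cone_piece_sums:
  assumes S: "S \<in> separating E W i j" and z: "z \<in> cone_piece E W i j S" and K: "up_closed E W K"
  shows "sum z S \<le> sum z K" "(j \<in> K \<longrightarrow> i \<in> K) \<Longrightarrow> 0 \<le> sum z K"
proof -
  from S have S': "up_closed E W S" "j \<in> S" "i \<in> W - S" by (auto simp: separating_def)
  have fin: "finite S" "finite (W - S)" "finite K"
    using W S' K finite_up_closed by blast+
  have "bal j S z \<in> cut_cone E S" "bal i (W - S) z \<in> cut_cone E (W - S)"
    using z by (simp_all add: cone_piece_def)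
  then have 1: "(if j \<in> K \<inter> S then sum z S else 0) \<le> sum z (K \<inter> S)"
    and 2: "(if i \<in> K - S then sum z (W - S) else 0) \<le> sum z (K - S)"
    unfolding bal_mem_cut_cone_iff[OF fin(1) S'(2)] bal_mem_cut_cone_iff[OF fin(2) S'(3)]
    using up_closed_restrict[OF S'(1) K] up_closed_Diff[OF K, of S] by blast+
  have 3: "sum z (W - S) = - sum z S"
    using z W S' sum_diff[of W S z] by (auto simp: cone_piece_def dest: up_closed_subset)
  have 4: "sum z K = sum z (K \<inter> S) + sum z (K - S)" by (rule sum.Int_Diff) fact
  have 5: "sum z S < 0" using z by (simp add: cone_piece_def)
  show "sum z S \<le> sum z K"
    using 1 2 S'(2,3) unfolding 3 4 by (cases "j \<in> K"; cases "i \<in> K") (use 5 in simp_all)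
  show "0 \<le> sum z K" if "j \<in> K \<longrightarrow> i \<in> K"
    using that 1 2 S'(2,3) unfolding 3 4 by (cases "j \<in> K"; cases "i \<in> K") (use 5 in simp_all)
qed

lemma cone_piece_subset:
  assumes "S \<in> separating E W i j"
  shows "cone_piece E W i j S \<subseteq> cut_cone (insert (i, j) E) W - cut_cone E W"
proof
  fix z assume z: "z \<in> cone_piece E W i j S"
  have "i \<in> W" "up_closed E W S" using assms by (auto simp: separating_def)
  then show "z \<in> cut_cone (insert (i, j) E) W - cut_cone E W"
    using cone_piece_sums(2)[OF assms z] z
    by (auto simp: cut_cone_def up_closed_insert cone_piece_def not_le)
qed

text \<open>Take \<open>S\<close> with the smallest sum among all cuts. The minimum is negative
  since an old inequality fails, and only cuts destroyed by the new edge can be negative, so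
  \<open>S\<close> separates \<open>j\<close> from \<open>i\<close>. Minimality then yields the
  inequalities of both factors.\<close>

lemma cut_cone_insert_cases:
  assumes ij: "i \<in> W"
    and z: "z \<in> cut_cone (insert (i, j) E) W" "z \<notin> cut_cone E W"
  shows "\<exists>S\<in>separating E W i j. z \<in> cone_piece E W i j S"
proof -
  have z0: "sum z W = 0" using z by (simp add: cut_cone_def)
  define F where "F = {S. up_closed E W S}"
  have F: "finite F" unfolding F_def
    by (rule finite_subset[of _ "Pow W"]) (use W in \<open>auto dest: up_closed_subset\<close>)
  from z obtain S0 where S0: "up_closed E W S0" "sum z S0 < 0"
    by (auto simp: cut_cone_def not_le)
  then have "F \<noteq> {}" by (auto simp: F_def)
  define S where "S = arg_min_on (sum z) F"
  have S: "up_closed E W S" using arg_min_if_finite(1)[OF F \<open>F \<noteq> {}\<close>, of "sum z"]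
    by (simp add: S_def F_def)
  have min: "sum z S \<le> sum z K" if "up_closed E W K" for K
    using arg_min_least[OF F \<open>F \<noteq> {}\<close>, of K "sum z"] that by (simp add: S_def F_def)
  have neg: "sum z S < 0" using min[OF S0(1)] S0(2) by simp
  have nonneg: "0 \<le> sum z K" if "up_closed E W K" "j \<in> K \<longrightarrow> i \<in> K" for K
    using z(1) that by (auto simp: cut_cone_def up_closed_insert)
  have "j \<in> S" "i \<notin> S" using nonneg[OF S] neg by auto
  have fin: "finite S" "finite (W - S)" using W S finite_up_closed by auto
  have co: "sum z (W - S) = - sum z S"
    using z0 W S sum_diff[of W S z] by (auto dest: up_closed_subset)
  have "bal j S z \<in> cut_cone E S"
    unfolding bal_mem_cut_cone_iff[OF fin(1) \<open>j \<in> S\<close>]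
  proof (intro allI impI)
    fix K assume K: "up_closed E S K"
    have "up_closed E W K" "i \<notin> K"
      using up_closed_trans[OF S K] up_closed_subset[OF K] \<open>i \<notin> S\<close> by auto
    \<comment> \<open>If \<open>j\<close> is in \<open>K\<close>, minimality applies; otherwise
      \<open>K\<close> survives the new edge.\<close>
    then show "(if j \<in> K then sum z S else 0) \<le> sum z K"
      using min[of K] nonneg[of K] by simp
  qed
  moreover have "bal i (W - S) z \<in> cut_cone E (W - S)"
    unfolding bal_mem_cut_cone_iff[OF fin(2) DiffI[OF ij \<open>i \<notin> S\<close>]]
  proof (intro allI impI)
    fix K assume K: "up_closed E (W - S) K"
    have "K \<inter> S = {}" "finite K" using up_closed_subset[OF K] W finite_subset by blast+
    then have "sum z (S \<union> K) = sum z S + sum z K"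
      using fin by (simp add: sum.union_disjoint Int_commute)
    \<comment> \<open>Cuts of the complement are tested after adding \<open>S\<close>: minimality
      gives \<open>0 <= sum z K\<close>, and when \<open>i\<close> is in \<open>K\<close> the
      enlarged cut survives the new edge.\<close>
    moreover have "sum z S \<le> sum z (S \<union> K)" "i \<in> K \<Longrightarrow> 0 \<le> sum z (S \<union> K)"
      using min[OF up_closed_Un_Diff[OF S K]] nonneg[OF up_closed_Un_Diff[OF S K]] by auto
    ultimately show "(if i \<in> K then sum z (W - S) else 0) \<le> sum z K"
      using co by auto
  qed
  ultimately show ?thesis using S neg \<open>j \<in> S\<close> \<open>i \<notin> S\<close> ij z0
    by (auto simp: separating_def cone_piece_def)
qed

text \<open>Both sets minimise the sum over cuts, and by modularity so does their intersection. The
  two differences, which miss \<open>j\<close>, therefore have sum zero, and genericity permits this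
  only for empty sets.\<close>

lemma cone_piece_inj:
  assumes S: "S \<in> separating E W i j" "z \<in> cone_piece E W i j S"
    and T: "T \<in> separating E W i j" "z \<in> cone_piece E W i j T"
    and generic: "\<And>K. K \<subseteq> W \<Longrightarrow> K \<noteq> {} \<Longrightarrow> K \<noteq> W \<Longrightarrow> sum z K \<noteq> 0"
  shows "S = T"
proof -
  have S': "up_closed E W S" "j \<in> S" and T': "up_closed E W T" "j \<in> T"
    using S T by (auto simp: separating_def)
  have fin: "finite S" "finite T" using W S' T' finite_up_closed by auto
  have eq: "sum z S = sum z T"
    using cone_piece_sums(1)[OF S T'(1)] cone_piece_sums(1)[OF T S'(1)] by simp
  have "sum z S \<le> sum z (S \<inter> T)" "sum z S \<le> sum z (S \<union> T)"
    using cone_piece_sums(1)[OF S] up_closed_Int[OF S'(1) T'(1)] up_closed_Un[OF S'(1) T'(1)] by auto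
  moreover have "sum z (S \<union> T) + sum z (S \<inter> T) = sum z S + sum z T"
    by (rule sum.union_inter) fact+
  ultimately have I: "sum z (S \<inter> T) = sum z S" using eq by simp
  have "sum z (S - T) = 0" "sum z (T - S) = 0"
    using sum.Int_Diff[OF fin(1), of z T] sum.Int_Diff[OF fin(2), of z S] I eq Int_commute[of S T]
    by (metis add_cancel_left_right)+
  moreover have "S \<subseteq> W" "T \<subseteq> W" using S' T' up_closed_subset by auto
  moreover from this have "S - T \<noteq> W" "T - S \<noteq> W" using S'(2) T'(2) by auto
  ultimately show ?thesis
    using generic[of "S - T"] generic[of "T - S"] by blast
qed

end

lemma cut_cone_insert_trivial:
  assumes "\<not> (i \<in> W \<and> j \<in> W \<and> i \<noteq> j)"
  shows "cut_cone (insert (i, j) E) W = cut_cone E W"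
  by (simp add: cut_cone_def up_closed_insert_trivial[OF assms])

subsection \<open>The cone is generated by the edge vectors\<close>

definition edge_flow :: "('v \<times> 'v) set \<Rightarrow> ('v \<times> 'v \<Rightarrow> real) \<Rightarrow> 'v \<Rightarrow> real" where
  "edge_flow E f k = (\<Sum>(a, b)\<in>E. f (a, b) * (of_bool (k = a) - of_bool (k = b)))"

text \<open>A Farkas statement by induction on the edges. Without edges, nonnegative coordinates of
  sum zero all vanish. If \<open>z\<close> is outside the old cone it lies in a piece, and the
  induction hypothesis gives flows for the balanced restrictions to \<open>S\<close> and
  \<open>W - S\<close>.\<close>

lemma cut_cone_edge_flow:
  assumes "finite E" "finite W" "z \<in> cut_cone E W"
  shows "\<exists>f. (\<forall>e. 0 \<le> f e) \<and> (\<forall>e. e \<notin> E \<inter> W \<times> W \<longrightarrow> f e = 0) \<and> (\<forall>k\<in>W. z k = edge_flow E f k)"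
  using assms
proof (induction E arbitrary: W z rule: finite_induct)
  case empty
  then have "0 \<le> z k" if "k \<in> W" for k
    using that by (auto simp: cut_cone_def up_closed_empty_edges dest: spec[of _ "{k}"])
  then have "z k = 0" if "k \<in> W" for k
    using that empty sum_nonneg_eq_0_iff[of W z] by (auto simp: cut_cone_def)
  then show ?case by (intro exI[of _ "\<lambda>_. 0"]) (simp add: edge_flow_def)
next
  case (insert e E)
  obtain i j where e: "e = (i, j)" by (cases e)
  have flow_insert: "edge_flow (insert e E) f k =
      edge_flow E f k + f e * (of_bool (k = i) - of_bool (k = j))" for f k
    using insert.hyps by (simp add: edge_flow_def e)
  show ?case
  proof (cases "z \<in> cut_cone E W")
    case True
    from insert.IH[OF insert.prems(1) True] obtain f where
      "\<forall>e. 0 \<le> f e" "\<forall>e. e \<notin> E \<inter> W \<times> W \<longrightarrow> f e = 0" "\<forall>k\<in>W. z k = edge_flow E f k"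
      by blast
    moreover from this have "f e = 0" using insert.hyps(2) by blast
    ultimately show ?thesis by (intro exI[of _ f]) (simp add: flow_insert)
  next
    case False
    have "i \<in> W \<and> j \<in> W \<and> i \<noteq> j"
      using False insert.prems(2) cut_cone_insert_trivial[of i W j E] unfolding e by blast
    then have ij: "i \<in> W" "j \<in> W" "i \<noteq> j" by auto
    from cut_cone_insert_cases[OF insert.prems(1) ij(1) insert.prems(2)[unfolded e] False]
    obtain S where S: "up_closed E W S" "j \<in> S" "i \<in> W" "i \<notin> S" and z: "z \<in> cone_piece E W i j S"
      by (auto simp: separating_def)
    have SW: "S \<subseteq> W" using S by (auto dest: up_closed_subset)
    have fin: "finite S" "finite (W - S)" using insert.prems(1) S finite_up_closed by auto
    from insert.IH[OF fin(1), of "bal j S z"] obtain f where f: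
      "\<forall>e. 0 \<le> f e" "\<forall>e. e \<notin> E \<inter> S \<times> S \<longrightarrow> f e = 0" "\<forall>k\<in>S. bal j S z k = edge_flow E f k"
      using z by (auto simp: cone_piece_def)
    from insert.IH[OF fin(2), of "bal i (W - S) z"] obtain g where g:
      "\<forall>e. 0 \<le> g e" "\<forall>e. e \<notin> E \<inter> (W - S) \<times> (W - S) \<longrightarrow> g e = 0"
      "\<forall>k\<in>W - S. bal i (W - S) z k = edge_flow E g k"
      using z by (auto simp: cone_piece_def)
    \<comment> \<open>The new edge carries the positive amount \<open>- sum z S\<close>; its
      contributions at \<open>i\<close> and \<open>j\<close> undo the changes made by
      balancing.\<close>
    define h where "h e' = f e' + g e' + (if e' = e then - sum z S else 0)" for e'
    have flow_off: "edge_flow E f k = 0" if "k \<notin> S" for k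
      unfolding edge_flow_def using that f(2) by (intro sum.neutral) auto
    have flow_off': "edge_flow E g k = 0" if "k \<in> S" for k
      unfolding edge_flow_def using that g(2) by (intro sum.neutral) auto
    have zneg: "sum z S < 0" and z0: "sum z W = 0" using z by (auto simp: cone_piece_def)
    have co: "sum z (W - S) = - sum z S"
      using z0 insert.prems(1) SW sum_diff[of W S z] by auto
    have "edge_flow E h k = edge_flow E f k + edge_flow E g k" for k
      unfolding edge_flow_def sum.distrib[symmetric]
      using insert.hyps(2) by (intro sum.cong) (auto simp: h_def algebra_simps)
    moreover have "f e = 0" "g e = 0" using f(2) g(2) insert.hyps(2) by blast+
    then have "h e = - sum z S" by (simp add: h_def)
    ultimately have flow_h: "edge_flow (insert e E) h k = edge_flow E f k + edge_flow E g k
        - sum z S * (of_bool (k = i) - of_bool (k = j))" for k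
      by (simp add: flow_insert)
    have "z k = edge_flow (insert e E) h k" if "k \<in> W" for k
    proof (cases "k \<in> S")
      case True
      have "sum z S = z j + sum z (S - {j})" using fin S by (simp add: sum.remove)
      then have "z k = bal j S z k + sum z S * of_bool (k = j)" by (simp add: bal_def)
      moreover have "k \<noteq> i" using True S by auto
      ultimately show ?thesis using True flow_off' f(3) by (simp add: flow_h)
    next
      case False
      have "sum z (W - S) = z i + sum z (W - S - {i})" using fin S by (simp add: sum.remove)
      then have "z k = bal i (W - S) z k - sum z S * of_bool (k = i)" using co by (simp add: bal_def)
      moreover have "k \<noteq> j" using False S by auto
      ultimately show ?thesis using False that flow_off g(3) by (simp add: flow_h)
    qed
    moreover have "0 \<le> h e'" for e' using f(1)[rule_format, of e'] g(1)[rule_format, of e'] zneg by (simp add: h_def)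
    moreover have "h e' = 0" if e': "e' \<notin> insert e E \<inter> W \<times> W" for e'
    proof -
      have "e' \<notin> E \<inter> S \<times> S" "e' \<notin> E \<inter> (W - S) \<times> (W - S)" "e' \<noteq> e"
        using e' SW ij by (auto simp: e)
      then show ?thesis
        using f(2)[rule_format, of e'] g(2)[rule_format, of e'] by (auto simp: h_def)
    qed
    ultimately show ?thesis by blast
  qed
qed

subsection \<open>Draconian sequences\<close>

text \<open>The conditional bound also covers the empty set, which arises when one cut is split
  along another.\<close>

lemma up_closed_nonempty_draconian:
  "w \<in> draconian A E W \<Longrightarrow> up_closed E W S \<Longrightarrow> (if S = {} then 0 else 1) \<le> sum w S"
  by (simp add: draconian_def)

text \<open>Applied to draconian \<open>u\<close> and \<open>v\<close> on \<open>S\<close> and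
  \<open>W - S\<close>, each of total \<open>1\<close>. Removing a unit at \<open>j\<close> in
  \<open>S\<close> makes the total over \<open>W\<close> equal to \<open>1\<close> and the sum over
  \<open>S\<close> equal to \<open>0\<close>, which violates the inequality of the old
  graph.\<close>

definition glue :: "'v \<Rightarrow> ('v \<Rightarrow> int) \<times> ('v \<Rightarrow> int) \<Rightarrow> 'v \<Rightarrow> int" where
  "glue j = (\<lambda>(u, v) k. u k + v k - of_bool (k = j))"

definition draconian_piece ::
  "'v set \<Rightarrow> ('v \<times> 'v) set \<Rightarrow> 'v set \<Rightarrow> 'v \<Rightarrow> 'v set \<Rightarrow> ('v \<Rightarrow> int) set" where
  "draconian_piece A E W j S = glue j ` (draconian A E S \<times> draconian A E (W - S))"

lemma card_draconian_piece:
  "card (draconian_piece A E W j S) = card (draconian A E S) * card (draconian A E (W - S))"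
proof -
  have "inj_on (glue j) (draconian A E S \<times> draconian A E (W - S))"
  proof (rule inj_onI, clarify)
    fix u v u' v' assume D: "u \<in> draconian A E S" "u' \<in> draconian A E S"
      "v \<in> draconian A E (W - S)" "v' \<in> draconian A E (W - S)" and "glue j (u, v) = glue j (u', v')"
    then have eq: "u k + v k = u' k + v' k" for k by (auto simp: glue_def fun_eq_iff)
    have "u k = u' k \<and> v k = v' k" for k
      using eq[of k] D by (cases "k \<in> S") (auto simp: draconian_def)
    then show "u = u' \<and> v = v'" by auto
  qed
  then show ?thesis by (simp add: draconian_piece_def card_image card_cartesian_product)
qed

context
  fixes A :: "'v set" and E :: "('v \<times> 'v) set" and W :: "'v set" and i j :: 'v
  assumes W: "finite W" and ij: "i \<in> W" "i \<in> A" "j \<notin> A" and E: "E \<subseteq> A \<times> - A"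
begin

text \<open>Each nonempty part of \<open>K\<close>, inside or outside \<open>S\<close>, contributes
  at least \<open>1\<close>, and the unit removed at \<open>j\<close> matters only when the part
  inside \<open>S\<close> is nonempty. So \<open>S\<close> is the largest cut with sum below
  \<open>1\<close>, which later gives uniqueness.\<close>

lemma sum_draconian_piece:
  assumes S: "S \<in> separating E W i j" and w: "w \<in> draconian_piece A E W j S"
    and K: "up_closed E W K"
  shows "K - S \<noteq> {} \<Longrightarrow> 1 \<le> sum w K" "j \<notin> K \<Longrightarrow> K \<noteq> {} \<Longrightarrow> 1 \<le> sum w K"
    "K = S \<Longrightarrow> sum w K = 0" "K = W \<Longrightarrow> sum w K = 1"
proof -
  have S': "up_closed E W S" "j \<in> S" "i \<in> W - S" using S by (auto simp: separating_def)
  obtain u v where w': "w = glue j (u, v)" and u: "u \<in> draconian A E S"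
    and v: "v \<in> draconian A E (W - S)"
    using w by (auto simp: draconian_piece_def)
  have fK: "finite K" using W K finite_up_closed by blast
  have "sum u K = sum u (K \<inter> S)" "sum v K = sum v (K - S)"
    using u v fK up_closed_subset[OF K]
    by (auto simp: draconian_def intro!: sum.mono_neutral_right)
  moreover have "sum w K = sum u K + sum v K - of_bool (j \<in> K)"
    using fK by (simp add: w' glue_def sum.distrib sum_subtractf of_bool_def)
  moreover have "(if K \<inter> S = {} then 0 else 1) \<le> sum u (K \<inter> S)"
    "(if K - S = {} then 0 else 1) \<le> sum v (K - S)"
    using up_closed_nonempty_draconian[OF u up_closed_restrict[OF S'(1) K]]
      up_closed_nonempty_draconian[OF v up_closed_Diff[OF K]] .
  ultimately have eq: "sum w K = sum u (K \<inter> S) + sum v (K - S) - of_bool (j \<in> K)"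
    and ineq: "(if K \<inter> S = {} then 0 else 1) \<le> sum u (K \<inter> S)"
    "(if K - S = {} then 0 else 1) \<le> sum v (K - S)" by simp_all
  show "1 \<le> sum w K" if "K - S \<noteq> {}"
  proof (cases "j \<in> K")
    case True
    then have "K \<inter> S \<noteq> {}" using S' by auto
    then show ?thesis using eq ineq that True by simp
  next
    case False
    have "0 \<le> sum u (K \<inter> S)" using ineq(1) by (simp split: if_splits)
    then show ?thesis using eq ineq that False by simp
  qed
  show "1 \<le> sum w K" if "j \<notin> K" "K \<noteq> {}"
  proof (cases "K - S = {}")
    case True
    then have "K \<inter> S = K" by auto
    then show ?thesis using eq ineq that True by simp
  next
    case False
    have "0 \<le> sum u (K \<inter> S)" using ineq(1) by (simp split: if_splits)
    then show ?thesis using eq ineq that False by simp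
  qed
  have "sum u S = 1" "sum v (W - S) = 1" using u v by (simp_all add: draconian_def)
  then show "K = S \<Longrightarrow> sum w K = 0" "K = W \<Longrightarrow> sum w K = 1"
    using eq S' up_closed_subset[OF S'(1)] by (auto simp: Int_absorb1)
qed

lemma draconian_piece_subset:
  assumes S: "S \<in> separating E W i j"
  shows "draconian_piece A E W j S \<subseteq> draconian A (insert (i, j) E) W - draconian A E W"
proof
  fix w assume w: "w \<in> draconian_piece A E W j S"
  have S': "up_closed E W S" "j \<in> S" "i \<in> W - S" using S by (auto simp: separating_def)
  have SW: "S \<subseteq> W" using S' up_closed_subset by auto
  have "up_closed E W W" by (auto simp: up_closed_def)
  then have "sum w W = 1" using sum_draconian_piece(4)[OF S w] by simp
  moreover have "1 \<le> sum w K" if K: "up_closed (insert (i, j) E) W K" "K \<noteq> {}" for K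
  proof -
    \<comment> \<open>A cut of the new graph containing \<open>j\<close> must contain
      \<open>i\<close>, which is outside \<open>S\<close>.\<close>
    have "up_closed E W K" "j \<in> K \<Longrightarrow> K - S \<noteq> {}"
      using K S' ij by (auto simp: up_closed_insert)
    then show ?thesis using sum_draconian_piece(1,2)[OF S w] K by blast
  qed
  moreover have "w k = 0" if "k \<notin> W" for k
    using w that subsetD[OF SW, of k] subsetD[OF SW, of j] S'
    by (fastforce simp: draconian_piece_def glue_def draconian_def)
  moreover have "w k = 1" if "k \<in> A \<inter> W" for k
    using w that ij by (cases "k \<in> S") (auto simp: draconian_piece_def glue_def draconian_def)
  ultimately have "w \<in> draconian A (insert (i, j) E) W" by (simp add: draconian_def)
  moreover have "w \<notin> draconian A E W"
    using up_closed_nonempty_draconian[of w A E W S] sum_draconian_piece(3)[OF S w S'(1)] S'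
    by (cases "S = {}") auto
  ultimately show "w \<in> draconian A (insert (i, j) E) W - draconian A E W" by simp
qed

text \<open>Ties between cuts do occur for integer vectors, so \<open>S\<close> is taken as large as
  possible among the separating cuts with sum at most \<open>0\<close>. Its sum is exactly
  \<open>0\<close>; a unit added at \<open>j\<close> gives the part on \<open>S\<close>, and
  maximality gives the inequalities on \<open>W - S\<close>.\<close>

lemma draconian_insert_cases:
  assumes w: "w \<in> draconian A (insert (i, j) E) W" "w \<notin> draconian A E W"
  shows "\<exists>S\<in>separating E W i j. w \<in> draconian_piece A E W j S"
proof -
  have wi: "w i = 1" using w ij by (simp add: draconian_def)
  have closed: "1 \<le> sum w K" if "up_closed E W K" "K \<noteq> {}" "j \<in> K \<Longrightarrow> i \<in> K" for K
    using w that by (auto simp: draconian_def up_closed_insert)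
  have nonneg: "0 \<le> sum w K" if K: "up_closed E W K" "j \<in> K" for K
  proof (cases "i \<in> K")
    case True
    then show ?thesis using closed[of K] K by fastforce
  next
    case False
    \<comment> \<open>No edge of \<open>E\<close> ends at \<open>i\<close>, which lies in
      \<open>A\<close>, so adding \<open>i\<close> imposes no further condition. The enlarged cut
      has sum at least \<open>1\<close>, of which \<open>i\<close> accounts for
      \<open>1\<close>.\<close>
    have "up_closed E W (insert i K)"
      using K E ij by (auto simp: up_closed_def)
    then have "1 \<le> sum w (insert i K)" using closed by blast
    then show ?thesis using False wi finite_up_closed[OF W K(1)] by simp
  qed
  define F where "F = {S \<in> separating E W i j. sum w S \<le> 0}"
  have F: "finite F" unfolding F_def using finite_separating[OF W] by simp
  have "\<exists>T. up_closed E W T \<and> T \<noteq> {} \<and> sum w T \<le> 0"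
    using w by (force simp: draconian_def)
  then obtain T where T: "up_closed E W T" "T \<noteq> {}" "sum w T \<le> 0" by blast
  then have "T \<in> F" using closed[of T] ij by (force simp: F_def separating_def)
  then have "F \<noteq> {}" by auto
  have "Max (card ` F) \<in> card ` F" using F \<open>F \<noteq> {}\<close> by simp
  then obtain S where SF: "S \<in> F" and card_S: "card S = Max (card ` F)" by auto
  then have S: "up_closed E W S" "j \<in> S" "i \<in> W" "i \<notin> S" "sum w S \<le> 0"
    by (auto simp: F_def separating_def)
  have S0: "sum w S = 0" using nonneg[OF S(1,2)] S(5) by simp
  have SW: "S \<subseteq> W" using S by (auto dest: up_closed_subset)
  have fS: "finite S" using W SW finite_subset by blast
  have max: "1 \<le> sum w K" if K: "up_closed E W K" "S \<subset> K" for K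
  proof (cases "i \<in> K")
    case True
    then show ?thesis using closed[OF K(1)] by auto
  next
    case False
    have "finite K" using W K(1) finite_up_closed by blast
    then have "card S < card K" using K(2) by (rule psubset_card_mono)
    then have "K \<notin> F" using Max_ge[of "card ` F" "card K"] F card_S by fastforce
    then show ?thesis using K False S by (force simp: F_def separating_def)
  qed
  define u where "u k = (if k \<in> S then w k + of_bool (k = j) else 0)" for k
  define v where "v k = (if k \<in> W - S then w k else 0)" for k
  have sum_u: "sum u K = sum w K + of_bool (j \<in> K)" if "K \<subseteq> S" for K
  proof -
    have "finite K" using that fS finite_subset by blast
    moreover have "sum u K = (\<Sum>k\<in>K. w k + of_bool (k = j))"
      using that by (intro sum.cong) (auto simp: u_def)
    ultimately show ?thesis by (simp add: sum.distrib of_bool_def)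
  qed
  \<comment> \<open>The vanishing sum over \<open>S\<close> lets a subset \<open>K\<close> of the
    complement be replaced by \<open>S \<union> K\<close>, to which maximality of \<open>S\<close>
    can be applied.\<close>
  have sum_v: "sum v K = sum w (S \<union> K)" if "K \<subseteq> W - S" for K
  proof -
    have "finite K" using that W finite_subset by blast
    moreover have "sum v K = sum w K" using that by (intro sum.cong) (auto simp: v_def)
    moreover have "S \<inter> K = {}" using that by auto
    ultimately show ?thesis using fS S0 by (simp add: sum.union_disjoint)
  qed
  have "u \<in> draconian A E S"
    unfolding draconian_def mem_Collect_eq
  proof (intro conjI allI impI ballI)
    show "u k = 0" if "k \<notin> S" for k using that by (simp add: u_def)
    show "u k = 1" if "k \<in> A \<inter> S" for k
      using that w(1) ij SW by (auto simp: u_def draconian_def)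
    show "sum u S = 1" using sum_u[of S] S S0 by simp
    fix K assume K: "up_closed E S K" "K \<noteq> {}"
    have K': "up_closed E W K" using up_closed_trans[OF S(1) K(1)] .
    show "1 \<le> sum u K"
      using sum_u[OF up_closed_subset[OF K(1)]] nonneg[OF K'] closed[OF K' K(2)]
      by (cases "j \<in> K") auto
  qed
  moreover have "v \<in> draconian A E (W - S)"
    unfolding draconian_def mem_Collect_eq
  proof (intro conjI allI impI ballI)
    show "v k = 0" if "k \<notin> W - S" for k using that by (auto simp: v_def)
    show "v k = 1" if "k \<in> A \<inter> (W - S)" for k
      using that w(1) by (auto simp: v_def draconian_def)
    show "sum v (W - S) = 1" using sum_v[of "W - S"] SW w(1) by (simp add: draconian_def Un_absorb1)
    fix K assume K: "up_closed E (W - S) K" "K \<noteq> {}"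
    have "S \<subset> S \<union> K" using K up_closed_subset[OF K(1)] by auto
    then show "1 \<le> sum v K"
      using sum_v[OF up_closed_subset[OF K(1)]] max[OF up_closed_Un_Diff[OF S(1) K(1)]] by simp
  qed
  moreover have "w = glue j (u, v)"
    using w(1) SW S by (auto simp: glue_def u_def v_def draconian_def fun_eq_iff)
  ultimately show ?thesis using S by (auto simp: draconian_piece_def separating_def)
qed

text \<open>If \<open>S\<close> were not inside \<open>T\<close>, its sum would be at least
  \<open>1\<close> by the piece of \<open>T\<close> but \<open>0\<close> by its own piece; the roles
  are symmetric.\<close>

lemma draconian_piece_inj:
  assumes S: "S \<in> separating E W i j" "w \<in> draconian_piece A E W j S"
    and T: "T \<in> separating E W i j" "w \<in> draconian_piece A E W j T"
  shows "S = T"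
proof -
  have S': "up_closed E W S" and T': "up_closed E W T" using S T by (auto simp: separating_def)
  show ?thesis
    using sum_draconian_piece(1)[OF S T'] sum_draconian_piece(3)[OF T T']
      sum_draconian_piece(1)[OF T S'] sum_draconian_piece(3)[OF S S'] by auto
qed

lemma draconian_insert:
  "draconian A (insert (i, j) E) W =
    draconian A E W \<union> (\<Union>S\<in>separating E W i j. draconian_piece A E W j S)"
proof -
  have "draconian A E W \<subseteq> draconian A (insert (i, j) E) W"
    by (auto simp: draconian_def up_closed_insert)
  then show ?thesis using draconian_piece_subset draconian_insert_cases by blast
qed

end

lemma draconian_insert_trivial:
  assumes "\<not> (i \<in> W \<and> j \<in> W \<and> i \<noteq> j)"
  shows "draconian A (insert (i, j) E) W = draconian A E W"
  by (simp add: draconian_def up_closed_insert_trivial[OF assms])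

text \<open>Every vertex has weight at least \<open>1\<close> while the total is \<open>1\<close>,
  so only a single vertex is possible.\<close>

lemma draconian_no_edges:
  assumes "finite W"
  shows "draconian A {} W = (if \<exists>v. W = {v} then {\<lambda>k. of_bool (k \<in> W)} else {})"
proof -
  have "card W = 1" if w: "w \<in> draconian A {} W" for w
  proof -
    have "1 \<le> w k" if "k \<in> W" for k
      using w that by (auto simp: draconian_def up_closed_empty_edges dest: spec[of _ "{k}"])
    then have "(\<Sum>k\<in>W. 1) \<le> sum w W" by (rule sum_mono)
    then have "card W \<le> 1" using w by (simp add: draconian_def)
    moreover have "W \<noteq> {}" using w by (auto simp: draconian_def)
    ultimately show ?thesis using assms by (simp add: le_Suc_eq card_gt_0_iff Suc_leI antisym)
  qed
  then have "draconian A {} W = {}" if "\<nexists>v. W = {v}"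
    using that by (auto simp: card_1_singleton_iff)
  moreover have "draconian A {} {v} = {\<lambda>k. of_bool (k = v)}" for v
    by (auto simp: draconian_def up_closed_empty_edges subset_singleton_iff fun_eq_iff)
  ultimately show ?thesis by auto
qed

text \<open>Makes the cardinalities in the recursion genuine counts, as \<open>card\<close> is
  \<open>0\<close> on infinite sets.\<close>

lemma finite_draconian:
  assumes "finite E" "E \<subseteq> A \<times> - A" "finite W"
  shows "finite (draconian A E W)"
  using assms
proof (induction E arbitrary: W rule: finite_induct)
  case empty
  then show ?case by (simp add: draconian_no_edges)
next
  case (insert e E)
  obtain i j where e: "e = (i, j)" by (cases e)
  show ?case
  proof (cases "i \<in> W \<and> j \<in> W \<and> i \<noteq> j")
    case True
    have fin: "finite (draconian A E W')" if "W' \<subseteq> W" for W'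
      using insert.IH insert.prems that finite_subset by blast
    have "S \<subseteq> W" if "S \<in> separating E W i j" for S
      using that by (auto simp: separating_def dest: up_closed_subset)
    then have "finite (draconian_piece A E W j S)" if "S \<in> separating E W i j" for S
      unfolding draconian_piece_def using that fin by auto
    then show ?thesis
      using fin[of W] finite_separating[OF insert.prems(2), of E i j] insert.prems True
      unfolding e by (subst draconian_insert) auto
  next
    case False
    then show ?thesis using insert by (simp add: e draconian_insert_trivial)
  qed
qed

text \<open>This is the recursion that \<open>cone_mass_insert\<close> reproduces for
  integrals.\<close>

lemma card_draconian_insert:
  assumes "finite E" "E \<subseteq> A \<times> - A" "finite W" "i \<in> W" "i \<in> A" "j \<notin> A"
  shows "card (draconian A (insert (i, j) E) W) = card (draconian A E W) +
    (\<Sum>S\<in>separating E W i j. card (draconian A E S) * card (draconian A E (W - S)))"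
proof -
  note ctxt = assms(3-6,2)
  have fin: "finite (draconian_piece A E W j S)" if "S \<in> separating E W i j" for S
  proof -
    have "finite S" using that assms(3) finite_up_closed by (auto simp: separating_def)
    then show ?thesis
      using finite_draconian[OF assms(1,2)] assms(3) by (simp add: draconian_piece_def)
  qed
  have "card (draconian A (insert (i, j) E) W) =
      card (draconian A E W) + card (\<Union>S\<in>separating E W i j. draconian_piece A E W j S)"
    unfolding draconian_insert[OF ctxt]
    using draconian_piece_subset[OF ctxt] fin finite_separating[OF assms(3)] finite_draconian[OF assms(1-3)]
    by (intro card_Un_disjoint) auto
  also have "card (\<Union>S\<in>separating E W i j. draconian_piece A E W j S) =
      (\<Sum>S\<in>separating E W i j. card (draconian_piece A E W j S))"
    using finite_separating[OF assms(3)] fin draconian_piece_inj[OF ctxt]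
    by (intro card_UN_disjoint ballI impI) (blast+)
  finally show ?thesis by (simp add: card_draconian_piece)
qed


subsection \<open>The exponential mass of the cone\<close>

abbreviation lborel_on :: "'v set \<Rightarrow> ('v \<Rightarrow> real) measure" where
  "lborel_on I \<equiv> Pi\<^sub>M I (\<lambda>_. lborel)"

interpretation lborel_product: product_sigma_finite "\<lambda>_. lborel :: real measure"
  by unfold_locales

section \<open>Measurability and null sets in product coordinates\<close>

lemma measurable_component_lborel_on:
  "k \<in> I \<Longrightarrow> (\<lambda>z. z k) \<in> borel_measurable (lborel_on I)"
  using measurable_component_singleton[of k I "\<lambda>_. lborel :: real measure"] by simp

lemma measurable_sum_lborel_on:
  "S \<subseteq> I \<Longrightarrow> (\<lambda>z. sum z S) \<in> borel_measurable (lborel_on I)"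
  by (intro borel_measurable_sum measurable_component_lborel_on) auto

lemma sum_fun_upd:
  fixes z :: "'v \<Rightarrow> real"
  assumes "finite S"
  shows "sum (z(k := y)) S = (if k \<in> S then y + sum z (S - {k}) else sum z S)"
proof (cases "k \<in> S")
  case True
  have "sum (z(k := y)) (S - {k}) = sum z (S - {k})" by (intro sum.cong) auto
  then show ?thesis using True assms by (simp add: sum.remove)
next
  case False
  then show ?thesis by (auto intro!: sum.cong)
qed

text \<open>Integrate first over one coordinate \<open>u\<close> of \<open>L\<close>: with the
  others fixed, the sum vanishes for a single value of it.\<close>

lemma AE_sum_nonzero:
  assumes I: "finite I" and L: "L \<subseteq> I" "L \<noteq> {}"
  shows "AE z in lborel_on I. sum z L \<noteq> 0"
proof -
  obtain u where u: "u \<in> L" using L by auto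
  define J where "J = I - {u}"
  have J: "finite J" "u \<notin> J" "I = insert u J" using I L u by (auto simp: J_def)
  have fL: "finite L" using I L finite_subset by blast
  define f :: "('a \<Rightarrow> real) \<Rightarrow> ennreal" where "f z = indicator {0} (sum z L)" for z
  have f: "f \<in> borel_measurable (lborel_on I)"
    unfolding f_def using measurable_sum_lborel_on[OF L(1)] by measurable
  have "(\<integral>\<^sup>+y. f (x(u := y)) \<partial>lborel) = 0" for x
  proof -
    have "(\<integral>\<^sup>+y. f (x(u := y)) \<partial>lborel) = (\<integral>\<^sup>+y. indicator {- sum x (L - {u})} y \<partial>lborel)"
      unfolding f_def sum_fun_upd[OF fL] using u
      by (intro nn_integral_cong) (auto simp: indicator_def)
    then show ?thesis by simp
  qed
  then have "(\<integral>\<^sup>+z. f z \<partial>lborel_on I) = 0"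
    using lborel_product.product_nn_integral_insert[OF J(1,2), of f] f by (simp flip: J(3))
  then have "AE z in lborel_on I. f z = 0" using f by (simp add: nn_integral_0_iff_AE)
  then show ?thesis by eventually_elim (simp add: f_def indicator_def split: if_splits)
qed

text \<open>Passing to the complement when \<open>v\<close> is in \<open>K\<close> avoids the value
  \<open>z v\<close>, so the expression is measurable in the coordinates
  \<open>W - {v}\<close>.\<close>

lemma sum_bal_alt:
  assumes "finite W" "v \<in> W" "K \<subseteq> W"
  shows "sum (bal v W z) K = (if v \<in> K then - sum z (W - K) else sum z K)"
  using sum_bal[OF assms, of z] sum_diff[OF assms(1,3), of z] by auto

text \<open>Up to sign each such sum is a sum over a nonempty subset of \<open>W - {v}\<close>, and
  there are finitely many of these.\<close>

lemma AE_bal_generic: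
  assumes W: "finite W" "v \<in> W"
  shows "AE z in lborel_on (W - {v}). \<forall>K. K \<subseteq> W \<longrightarrow> K \<noteq> {} \<longrightarrow> K \<noteq> W \<longrightarrow> sum (bal v W z) K \<noteq> 0"
proof -
  have "AE z in lborel_on (W - {v}). \<forall>L\<in>Pow (W - {v}) - {{}}. sum z L \<noteq> 0"
    using W by (intro AE_finite_allI AE_sum_nonzero) auto
  then show ?thesis
  proof eventually_elim
    case (elim z)
    show ?case
    proof (intro allI impI)
      fix K assume K: "K \<subseteq> W" "K \<noteq> {}" "K \<noteq> W"
      show "sum (bal v W z) K \<noteq> 0"
      proof (cases "v \<in> K")
        case True
        then have "W - K \<in> Pow (W - {v}) - {{}}" using K by auto
        then show ?thesis using elim True unfolding sum_bal_alt[OF W K(1)] by fastforce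
      next
        case False
        then have "K \<in> Pow (W - {v}) - {{}}" using K by auto
        then show ?thesis using elim False unfolding sum_bal_alt[OF W K(1)] by fastforce
      qed
    qed
  qed
qed

text \<open>Weighting by the left sum makes the density multiplicative on a piece: a multiple
  \<open>t\<close> of the new edge vector adds \<open>t\<close> to the left sum.\<close>

definition cone_density :: "'v set \<Rightarrow> ('v \<times> 'v) set \<Rightarrow> 'v set \<Rightarrow> ('v \<Rightarrow> real) \<Rightarrow> ennreal" where
  "cone_density A E W z = indicator (cut_cone E W) z * ennreal (exp (- sum z (A \<inter> W)))"

text \<open>The integral is over the hyperplane \<open>sum z W = 0\<close>, with the coordinate \<open>v\<close> eliminated.\<close>
definition cone_mass :: "'v set \<Rightarrow> ('v \<times> 'v) set \<Rightarrow> 'v set \<Rightarrow> 'v \<Rightarrow> ennreal" where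
  "cone_mass A E W v = (\<integral>\<^sup>+z. cone_density A E W (bal v W z) \<partial>lborel_on (W - {v}))"

lemma cone_density_cong:
  assumes "\<And>k. k \<in> W \<Longrightarrow> z k = z' k"
  shows "cone_density A E W z = cone_density A E W z'"
proof -
  have "sum z S = sum z' S" if "S \<subseteq> W" for S
    using that assms by (intro sum.cong) auto
  then have "z \<in> cut_cone E W \<longleftrightarrow> z' \<in> cut_cone E W" "sum z (A \<inter> W) = sum z' (A \<inter> W)"
    unfolding cut_cone_def by (simp_all add: up_closed_subset cong: imp_cong)
  then show ?thesis by (simp add: cone_density_def indicator_def)
qed

lemma measurable_cone_density:
  assumes W: "finite W" "v \<in> W"
  shows "(\<lambda>z. cone_density A E W (bal v W z)) \<in> borel_measurable (lborel_on (W - {v}))"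
proof -
  have m: "(\<lambda>z. sum (bal v W z) K) \<in> borel_measurable (lborel_on (W - {v}))" if "K \<subseteq> W" for K
    unfolding sum_bal_alt[OF W that] using that
    by (cases "v \<in> K") (auto intro!: measurable_sum_lborel_on borel_measurable_uminus)
  have "bal v W z \<in> cut_cone E W \<longleftrightarrow> (\<forall>K\<in>{K \<in> Pow W. up_closed E W K}. 0 \<le> sum (bal v W z) K)" for z
    using sum_bal_self[OF W, of z] up_closed_subset[of E W] unfolding cut_cone_def by blast
  moreover have "Measurable.pred (lborel_on (W - {v}))
      (\<lambda>z. \<forall>K\<in>{K \<in> Pow W. up_closed E W K}. 0 \<le> sum (bal v W z) K)"
    using W m by (intro pred_intros_finite) (auto intro!: borel_measurable_le)
  ultimately have [measurable]: "Measurable.pred (lborel_on (W - {v})) (\<lambda>z. bal v W z \<in> cut_cone E W)"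
    by simp
  have [measurable]: "(\<lambda>z. sum (bal v W z) (A \<inter> W)) \<in> borel_measurable (lborel_on (W - {v}))"
    by (rule m) auto
  show ?thesis unfolding cone_density_def by measurable
qed

text \<open>Exchanging the eliminated coordinate is, with the rest fixed, the reflection
  \<open>y -> - sum x I - y\<close>, which preserves Lebesgue measure.\<close>

lemma cone_mass_root:
  assumes W: "finite W" "u \<in> W" "v \<in> W"
  shows "cone_mass A E W u = cone_mass A E W v"
proof (cases "u = v")
  case False
  define I where "I = W - {u, v}"
  have I: "finite I" "u \<notin> I" "v \<notin> I" "W - {v} = insert u I" "W - {u} = insert v I"
    using W False by (auto simp: I_def)
  let ?D = "cone_density A E W"
  have eq: "bal v W (x(u := - sum x I + - 1 * y)) = bal u W (x(v := y))" for x y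
  proof -
    have "sum (x(w := a)) (insert w I) = a + sum x I" if "w \<notin> I" for w a
      using I(1) that sum_fun_upd[of "insert w I" x w a] by simp
    then show ?thesis using I False by (simp add: bal_def fun_upd_twist algebra_simps del: fun_upd_apply)
  qed
  have inner: "(\<integral>\<^sup>+y. ?D (bal v W (x(u := y))) \<partial>lborel) = (\<integral>\<^sup>+y. ?D (bal u W (x(v := y))) \<partial>lborel)"
    if x: "x \<in> space (lborel_on I)" for x
  proof -
    have "(\<lambda>y. x(u := y)) \<in> lborel \<rightarrow>\<^sub>M lborel_on (insert u I)"
      using x I(2) by (rule measurable_component_update)
    from measurable_compose[OF this, of "\<lambda>z. ?D (bal v W z)" borel]
    have "(\<lambda>y. ?D (bal v W (x(u := y)))) \<in> borel_measurable borel"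
      using measurable_cone_density[OF W(1,3), of A E] by (simp add: I(4))
    from nn_integral_real_affine[OF this, of "-1" "- sum x I"] show ?thesis
      unfolding eq by simp
  qed
  have "cone_mass A E W v = (\<integral>\<^sup>+x. \<integral>\<^sup>+y. ?D (bal v W (x(u := y))) \<partial>lborel \<partial>lborel_on I)"
    using lborel_product.product_nn_integral_insert[OF I(1,2)] measurable_cone_density[OF W(1,3), of A E]
    by (simp add: cone_mass_def I(4))
  also have "\<dots> = (\<integral>\<^sup>+x. \<integral>\<^sup>+y. ?D (bal u W (x(v := y))) \<partial>lborel \<partial>lborel_on I)"
    by (intro nn_integral_cong inner)
  also have "\<dots> = cone_mass A E W u"
    using lborel_product.product_nn_integral_insert[OF I(1,3)] measurable_cone_density[OF W(1,2), of A E]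
    by (simp add: cone_mass_def I(5))
  finally show ?thesis ..
qed simp

text \<open>The half-line factor of a piece has mass \<open>1\<close>; the shift \<open>c\<close>
  will be the sum of the other coordinates of \<open>W - S\<close>.\<close>

lemma nn_integral_exp_shift:
  "(\<integral>\<^sup>+y. indicator {0<..} (y + c) * ennreal (exp (- (y + c))) \<partial>lborel) = 1" for c :: real
proof -
  have "(\<integral>\<^sup>+y. indicator {0<..} (y + c) * ennreal (exp (- (y + c))) \<partial>lborel) =
      (\<integral>\<^sup>+t. indicator {0<..} t * ennreal (exp (- t)) \<partial>lborel)"
    using nn_integral_real_affine[of "\<lambda>t. indicator {0<..} t * ennreal (exp (- t))" 1 c]
    by (simp add: add.commute)
  also have "\<dots> = (\<integral>\<^sup>+t. ennreal (exp (- t)) * indicator {0..} t \<partial>lborel)"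
  proof (rule nn_integral_cong_AE)
    show "AE t in lborel. indicator {0<..} t * ennreal (exp (- t)) = ennreal (exp (- t)) * indicator {0..} t"
      using AE_lborel_singleton[of "0::real"] by eventually_elim (auto simp: indicator_def)
  qed
  also have "\<dots> = ennreal (0 - - exp (- 0))"
  proof (rule nn_integral_FTC_atLeast)
    show "((\<lambda>x::real. - exp (- x)) \<longlongrightarrow> 0) at_top"
      using tendsto_minus[OF filterlim_compose[OF exp_at_bot filterlim_uminus_at_bot_at_top]] by simp
  qed (auto intro!: derivative_eq_intros)
  finally show ?thesis by simp
qed

text \<open>The coordinates \<open>W - {j}\<close> split into \<open>i\<close>,
  \<open>S - {j}\<close> and \<open>W - S - {i}\<close>. Each density uses one of the two blocks,
  and for fixed blocks the coefficient \<open>sum z (W - S)\<close> of the new edge vector is a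
  translate of the coordinate \<open>i\<close>, so no Jacobian appears.\<close>

lemma cone_mass_piece:
  fixes A :: "'v set"
  assumes W: "finite W" and S: "S \<in> separating E W i j"
  defines "P \<equiv> \<lambda>z. cone_density A E S (bal j S z) * cone_density A E (W - S) (bal i (W - S) z) *
      (indicator {0<..} (sum z (W - S)) * ennreal (exp (- sum z (W - S))))"
  shows "P \<in> borel_measurable (lborel_on (W - {j}))"
    and "(\<integral>\<^sup>+z. P z \<partial>lborel_on (W - {j})) = cone_mass A E S j * cone_mass A E (W - S) i"
proof -
  have S': "S \<subseteq> W" "j \<in> S" "i \<in> W" "i \<notin> S"
    using S by (auto simp: separating_def dest: up_closed_subset)
  have fin: "finite S" "finite (W - S)" using W S' finite_subset by auto
  define I where "I = S - {j}"
  define J where "J = W - S - {i}"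
  have IJ: "finite I" "finite J" "I \<inter> J = {}" "i \<notin> I \<union> J" "W - {j} = insert i (I \<union> J)"
    using fin S' by (auto simp: I_def J_def)
  let ?f = "\<lambda>z. cone_density A E S (bal j S z)"
  let ?g = "\<lambda>z. cone_density A E (W - S) (bal i (W - S) z)"
  have f: "?f \<in> borel_measurable (lborel_on I)"
    unfolding I_def by (rule measurable_cone_density) (use fin S' in auto)
  have g: "?g \<in> borel_measurable (lborel_on J)"
    unfolding J_def by (rule measurable_cone_density) (use fin S' in auto)
  have f_cong: "?f z = ?f z'" if "\<And>k. k \<in> I \<Longrightarrow> z k = z' k" for z z'
  proof (rule cone_density_cong)
    fix k assume "k \<in> S"
    moreover have "sum z (S - {j}) = sum z' (S - {j})" using that by (intro sum.cong) (auto simp: I_def)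
    ultimately show "bal j S z k = bal j S z' k" using that by (simp add: bal_def I_def)
  qed
  have g_cong: "?g z = ?g z'" if "\<And>k. k \<in> J \<Longrightarrow> z k = z' k" for z z'
  proof (rule cone_density_cong)
    fix k assume "k \<in> W - S"
    moreover have "sum z (W - S - {i}) = sum z' (W - S - {i})" using that by (intro sum.cong) (auto simp: J_def)
    ultimately show "bal i (W - S) z k = bal i (W - S) z' k" using that by (simp add: bal_def J_def)
  qed
  have restr: "(\<lambda>z. restrict z K) \<in> lborel_on K' \<rightarrow>\<^sub>M lborel_on K" if "K \<subseteq> K'" for K K' :: "'v set"
    using that by (rule measurable_restrict_subset)
  have f': "?f \<in> borel_measurable (lborel_on K)" if "I \<subseteq> K" for K
  proof -
    have "?f = (\<lambda>z. ?f (restrict z I))" by (intro ext f_cong) simp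
    then show ?thesis using measurable_compose[OF restr[OF that] f] by simp
  qed
  have g': "?g \<in> borel_measurable (lborel_on K)" if "J \<subseteq> K" for K
  proof -
    have "?g = (\<lambda>z. ?g (restrict z J))" by (intro ext g_cong) simp
    then show ?thesis using measurable_compose[OF restr[OF that] g] by simp
  qed
  have h: "(\<lambda>z. sum z (W - S)) \<in> borel_measurable (lborel_on (W - {j}))"
    using S' by (intro measurable_sum_lborel_on) auto
  have fg [measurable]: "?f \<in> borel_measurable (lborel_on (W - {j}))"
    "?g \<in> borel_measurable (lborel_on (W - {j}))"
    by (rule f' g'; use IJ in auto)+
  note h [measurable]
  show P: "P \<in> borel_measurable (lborel_on (W - {j}))"
    unfolding P_def by measurable
  have inner: "(\<integral>\<^sup>+y. P (x(i := y)) \<partial>lborel) = ?f x * ?g x" for x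
  proof -
    have mh: "(\<lambda>y. indicator {0<..} (y + sum x J) * ennreal (exp (- (y + sum x J))))
        \<in> borel_measurable lborel" by measurable
    have "?f (x(i := y)) = ?f x" "?g (x(i := y)) = ?g x" for y
      using IJ by (auto intro!: f_cong g_cong)
    moreover have "sum (x(i := y)) (W - S) = y + sum x J" for y
      unfolding sum_fun_upd[OF fin(2)] using S' by (simp add: J_def)
    ultimately have "(\<integral>\<^sup>+y. P (x(i := y)) \<partial>lborel) = (\<integral>\<^sup>+y. ?f x * ?g x *
        (indicator {0<..} (y + sum x J) * ennreal (exp (- (y + sum x J)))) \<partial>lborel)"
      unfolding P_def by presburger
    also have "\<dots> = ?f x * ?g x"
      unfolding nn_integral_cmult[OF mh] nn_integral_exp_shift by simp
    finally show ?thesis .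
  qed
  have "(\<integral>\<^sup>+z. P z \<partial>lborel_on (W - {j})) = (\<integral>\<^sup>+x. ?f x * ?g x \<partial>lborel_on (I \<union> J))"
    using lborel_product.product_nn_integral_insert[OF _ IJ(4), of P] IJ P inner by simp
  also have "\<dots> = (\<integral>\<^sup>+x. \<integral>\<^sup>+y. ?f (merge I J (x, y)) * ?g (merge I J (x, y)) \<partial>lborel_on J \<partial>lborel_on I)"
  proof -
    have [measurable]: "?f \<in> borel_measurable (lborel_on (I \<union> J))"
      "?g \<in> borel_measurable (lborel_on (I \<union> J))"
      by (rule f' g'; simp)+
    have "(\<lambda>x. ?f x * ?g x) \<in> borel_measurable (lborel_on (I \<union> J))" by measurable
    from lborel_product.product_nn_integral_fold[OF IJ(3,1,2) this] show ?thesis .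
  qed
  also have "\<dots> = (\<integral>\<^sup>+x. \<integral>\<^sup>+y. ?f x * ?g y \<partial>lborel_on J \<partial>lborel_on I)"
  proof (intro nn_integral_cong arg_cong2[of _ _ _ _ "(*)"] f_cong g_cong)
    show "merge I J (x, y) k = x k" if "k \<in> I" for x y k using that by (simp add: merge_def)
    show "merge I J (x, y) k = y k" if "k \<in> J" for x y k using that IJ by (auto simp: merge_def)
  qed
  also have "\<dots> = (\<integral>\<^sup>+x. ?f x * cone_mass A E (W - S) i \<partial>lborel_on I)"
    using g by (simp add: nn_integral_cmult cone_mass_def J_def)
  also have "\<dots> = cone_mass A E S j * cone_mass A E (W - S) i"
    using f by (simp add: nn_integral_multc cone_mass_def I_def)
  finally show "(\<integral>\<^sup>+z. P z \<partial>lborel_on (W - {j})) = cone_mass A E S j * cone_mass A E (W - S) i" .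
qed

text \<open>At generic points the pieces are disjoint, so the indicators add. Within a piece the
  left sum splits into those of the two factors and the coefficient of the new edge vector, so the
  exponential factorises.\<close>

lemma cone_density_insert:
  assumes W: "finite W" and ij: "i \<in> W" "j \<in> W" "i \<noteq> j" "i \<in> A" "j \<notin> A"
    and generic: "\<And>K. K \<subseteq> W \<Longrightarrow> K \<noteq> {} \<Longrightarrow> K \<noteq> W \<Longrightarrow> sum (bal j W z) K \<noteq> 0"
  shows "cone_density A (insert (i, j) E) W (bal j W z) = cone_density A E W (bal j W z) +
    (\<Sum>S\<in>separating E W i j. cone_density A E S (bal j S z) *
      cone_density A E (W - S) (bal i (W - S) z) *
      (indicator {0<..} (sum z (W - S)) * ennreal (exp (- sum z (W - S)))))"
proof -
  let ?z = "bal j W z"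
  let ?e = "ennreal (exp (- sum ?z (A \<inter> W)))"
  have piece: "cone_density A E S (bal j S z) * cone_density A E (W - S) (bal i (W - S) z) *
      (indicator {0<..} (sum z (W - S)) * ennreal (exp (- sum z (W - S)))) =
      indicator (cone_piece E W i j S) ?z * ?e" if "S \<in> separating E W i j" for S
  proof -
    have S: "S \<subseteq> W" "j \<in> S" "i \<in> W - S"
      using that by (auto simp: separating_def dest: up_closed_subset)
    have fin: "finite S" "finite (W - S)" using W S finite_subset by auto
    have 1: "sum ?z W = 0" using W ij by (simp add: sum_bal_self)
    have 2: "sum ?z S = - sum z (W - S)" using S by (simp add: sum_bal_alt[OF W ij(2) S(1)])
    have 3: "bal j S ?z = bal j S z"
    proof -
      have "sum ?z (S - {j}) = sum z (S - {j})" by (intro sum.cong) (auto simp: bal_def)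
      then show ?thesis by (simp add: bal_def)
    qed
    have 4: "bal i (W - S) ?z \<in> cut_cone E (W - S) \<longleftrightarrow> bal i (W - S) z \<in> cut_cone E (W - S)"
    proof -
      have "sum ?z K = sum z K" if "K \<subseteq> W - S" for K
        using that S by (intro sum.cong) (auto simp: bal_def)
      then show ?thesis
        unfolding bal_mem_cut_cone_iff[OF fin(2) S(3)] by (simp add: up_closed_subset cong: imp_cong)
    qed
    \<comment> \<open>Balancing at \<open>i\<close> lowers the left sum by the total over
      \<open>W - S\<close>, whereas balancing at \<open>j\<close> does not affect it, since
      \<open>j\<close> is not in \<open>A\<close>.\<close>
    have 5: "sum ?z (A \<inter> W) =
        sum (bal j S z) (A \<inter> S) + sum (bal i (W - S) z) (A \<inter> (W - S)) + sum z (W - S)"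
    proof -
      have "sum (bal i (W - S) z) (A \<inter> (W - S)) = sum z (A \<inter> (W - S)) - sum z (W - S)"
        using sum_bal[OF fin(2) S(3), of "A \<inter> (W - S)"] ij S by simp
      moreover have "sum (bal j S z) (A \<inter> S) = sum z (A \<inter> S)"
        using sum_bal[OF fin(1) S(2), of "A \<inter> S"] ij by simp
      moreover have "sum ?z (A \<inter> W) = sum z (A \<inter> W)"
        using sum_bal[OF W ij(2), of "A \<inter> W"] ij by simp
      moreover have "sum z (A \<inter> W) = sum z (A \<inter> S) + sum z (A \<inter> (W - S))"
        using sum.Int_Diff[of "A \<inter> W" z S] W S by (simp add: Int_assoc Int_Diff Int_absorb1 Int_absorb2)
      ultimately show ?thesis by simp
    qed
    have "exp (- sum ?z (A \<inter> W)) = exp (- sum (bal j S z) (A \<inter> S)) *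
        exp (- sum (bal i (W - S) z) (A \<inter> (W - S))) * exp (- sum z (W - S))"
      unfolding 5 by (simp flip: exp_add)
    then show ?thesis
      unfolding cone_density_def cone_piece_def indicator_def mem_Collect_eq 1 2 3 4
      by (auto simp: ennreal_mult)
  qed
  have "indicator (cut_cone (insert (i, j) E) W) ?z =
      indicator (cut_cone E W) ?z + (\<Sum>S\<in>separating E W i j. indicator (cone_piece E W i j S) ?z :: ennreal)"
  proof (cases "\<exists>S\<in>separating E W i j. ?z \<in> cone_piece E W i j S")
    case True
    then obtain S where S: "S \<in> separating E W i j" "?z \<in> cone_piece E W i j S" by blast
    have "indicator (cone_piece E W i j T) ?z = (if T = S then 1 else 0 :: ennreal)"
      if "T \<in> separating E W i j" for T
    proof (cases "?z \<in> cone_piece E W i j T")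
      case True
      then have "T = S" using cone_piece_inj[OF W that _ S(1) S(2) generic] by simp
      then show ?thesis using S by simp
    next
      case False
      then show ?thesis using S by auto
    qed
    then have "(\<Sum>T\<in>separating E W i j. indicator (cone_piece E W i j T) ?z :: ennreal) =
        (\<Sum>T\<in>separating E W i j. if T = S then 1 else 0)"
      by (rule sum.cong[OF refl])
    also have "\<dots> = 1" using S finite_separating[OF W, of E i j] by simp
    finally show ?thesis
      using S cone_piece_subset[OF W S(1)] by (auto simp: indicator_def)
  next
    case False
    then have "?z \<in> cut_cone (insert (i, j) E) W \<longleftrightarrow> ?z \<in> cut_cone E W"
      using cut_cone_insert_cases[OF W ij(1), of ?z j E]
      by (auto simp: cut_cone_def up_closed_insert)
    moreover have "(\<Sum>S\<in>separating E W i j. indicator (cone_piece E W i j S) ?z :: ennreal) = 0"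
      using False by (intro sum.neutral) auto
    ultimately show ?thesis by (simp add: indicator_def)
  qed
  then show ?thesis
    using piece by (simp add: cone_density_def distrib_right sum_distrib_right)
qed

lemma cone_mass_insert:
  assumes W: "finite W" and ij: "i \<in> W" "j \<in> W" "i \<noteq> j" "i \<in> A" "j \<notin> A"
  shows "cone_mass A (insert (i, j) E) W j = cone_mass A E W j +
    (\<Sum>S\<in>separating E W i j. cone_mass A E S j * cone_mass A E (W - S) i)"
proof -
  let ?P = "\<lambda>S z. cone_density A E S (bal j S z) * cone_density A E (W - S) (bal i (W - S) z) *
      (indicator {0<..} (sum z (W - S)) * ennreal (exp (- sum z (W - S))))"
  have "cone_mass A (insert (i, j) E) W j = (\<integral>\<^sup>+z. cone_density A E W (bal j W z) +
      (\<Sum>S\<in>separating E W i j. ?P S z) \<partial>lborel_on (W - {j}))"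
    unfolding cone_mass_def
  proof (rule nn_integral_cong_AE)
    show "AE z in lborel_on (W - {j}). cone_density A (insert (i, j) E) W (bal j W z) =
        cone_density A E W (bal j W z) + (\<Sum>S\<in>separating E W i j. ?P S z)"
      using AE_bal_generic[OF W ij(2)]
    proof eventually_elim
      case (elim z)
      then show ?case by (intro cone_density_insert[OF assms]) auto
    qed
  qed
  also have "\<dots> = cone_mass A E W j + (\<Sum>S\<in>separating E W i j. \<integral>\<^sup>+z. ?P S z \<partial>lborel_on (W - {j}))"
    unfolding cone_mass_def
    using measurable_cone_density[OF W ij(2)] cone_mass_piece(1)[OF W, of _ E i j A]
    by (subst nn_integral_add) (auto intro!: borel_measurable_sum simp: nn_integral_sum)
  also have "(\<Sum>S\<in>separating E W i j. \<integral>\<^sup>+z. ?P S z \<partial>lborel_on (W - {j})) =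
      (\<Sum>S\<in>separating E W i j. cone_mass A E S j * cone_mass A E (W - S) i)"
    by (intro sum.cong refl cone_mass_piece(2)[OF W])
  finally show ?thesis .
qed

text \<open>With at least two vertices, points of the cone have vanishing coordinates, which
  genericity excludes. For a single vertex the integral is over a one-point space.\<close>

lemma cone_mass_no_edges:
  assumes W: "finite W" "v \<in> W"
  shows "cone_mass A {} W v = (if W = {v} then 1 else 0)"
proof (cases "W = {v}")
  case True
  \<comment> \<open>The product over no coordinates is a unit mass at
    \<open>\<lambda>_. undefined\<close>.\<close>
  have "cone_mass A {} {v} v = cone_density A {} {v} (bal v {v} (\<lambda>_. undefined))"
    by (simp add: cone_mass_def PiM_empty nn_integral_count_space_finite)
  also have "\<dots> = 1"
  proof -
    let ?z = "bal v {v} (\<lambda>_. undefined)"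
    have sum0: "sum ?z S = 0" if "S \<subseteq> {v}" for S
      using that by (auto simp: subset_singleton_iff bal_def)
    have "sum ?z (A \<inter> {v}) = 0" by (rule sum0) auto
    moreover have "?z \<in> cut_cone {} {v}"
      unfolding cut_cone_def up_closed_empty_edges
      by (intro CollectI conjI allI impI) (simp_all only: sum0 order_refl)
    ultimately show ?thesis by (simp only: cone_density_def indicator_simps) simp
  qed
  finally show ?thesis using True by simp
next
  case False
  then obtain u where u: "u \<in> W" "u \<noteq> v" using W by blast
  have "cone_density A {} W (bal v W z) = 0"
    if generic: "\<forall>K. K \<subseteq> W \<longrightarrow> K \<noteq> {} \<longrightarrow> K \<noteq> W \<longrightarrow> sum (bal v W z) K \<noteq> 0" for z
  proof -
    have "sum (bal v W z) {u} \<noteq> 0" using generic u W by blast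
    moreover have "sum (bal v W z) (W - {u}) = - sum (bal v W z) {u}"
      using W u sum_bal_self[OF W, of z] by (simp add: sum_diff1)
    ultimately have "bal v W z \<notin> cut_cone {} W"
    proof (intro notI)
      assume "bal v W z \<in> cut_cone {} W"
      then have nonneg: "0 \<le> sum (bal v W z) S" if "S \<subseteq> W" for S
        using that unfolding cut_cone_def up_closed_empty_edges by blast
      \<comment> \<open>In the cone both \<open>{u}\<close> and its complement have nonnegative
        sums, yet these are opposite.\<close>
      have "0 \<le> sum (bal v W z) {u}" "0 \<le> sum (bal v W z) (W - {u})"
        by (rule nonneg; use u in blast)+
      then show False
        using \<open>sum (bal v W z) {u} \<noteq> 0\<close> \<open>sum (bal v W z) (W - {u}) = - sum (bal v W z) {u}\<close> by linarith
    qed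
    then show ?thesis by (simp add: cone_density_def)
  qed
  then have "AE z in lborel_on (W - {v}). cone_density A {} W (bal v W z) = 0"
    using AE_bal_generic[OF W] by (rule AE_mp[rotated, OF AE_I2[OF impI]])
  then have "cone_mass A {} W v = 0"
    unfolding cone_mass_def using measurable_cone_density[OF W] by (subst nn_integral_0_iff_AE) auto
  then show ?thesis using False by simp
qed

text \<open>\<open>W\<close> and \<open>v\<close> vary in the induction because the recursion passes
  to \<open>S\<close> and \<open>W - S\<close> with eliminated vertices \<open>j\<close> and
  \<open>i\<close>; \<open>cone_mass_root\<close> first moves the elimination to
  \<open>j\<close>.\<close>

theorem cone_mass_eq_card_draconian:
  assumes "finite E" "E \<subseteq> A \<times> - A" "finite W" "v \<in> W"
  shows "cone_mass A E W v = of_nat (card (draconian A E W))"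
  using assms
proof (induction E arbitrary: W v rule: finite_induct)
  case empty
  then show ?case by (auto simp: cone_mass_no_edges draconian_no_edges)
next
  case (insert e E)
  obtain i j where e: "e = (i, j)" by (cases e)
  have E: "E \<subseteq> A \<times> - A" "i \<in> A" "j \<notin> A" using insert.prems by (auto simp: e)
  note W = insert.prems(2,3)
  show ?case
  proof (cases "i \<in> W \<and> j \<in> W \<and> i \<noteq> j")
    case True
    then have ij: "i \<in> W" "j \<in> W" "i \<noteq> j" by auto
    have "cone_mass A E S j * cone_mass A E (W - S) i =
        of_nat (card (draconian A E S) * card (draconian A E (W - S)))" if "S \<in> separating E W i j" for S
    proof -
      have "finite S" "j \<in> S" "i \<in> W - S" using that W(1) finite_up_closed by (auto simp: separating_def)
      then show ?thesis using insert.IH[OF E(1)] W(1) by simp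
    qed
    then show ?thesis
      using cone_mass_root[OF W(1) W(2) ij(2)] cone_mass_insert[OF W(1) ij E(2,3)]
        card_draconian_insert[OF insert.hyps(1) E(1) W(1) ij(1) E(2,3)] insert.IH[OF E(1) W(1) ij(2)]
      by (simp add: e)
  next
    case False
    then have "cone_mass A (insert e E) W v = cone_mass A E W v"
      by (simp add: e cone_mass_def cone_density_def cut_cone_insert_trivial)
    then show ?thesis
      using insert.IH[OF E(1) W] draconian_insert_trivial[OF False, of A E] by (simp add: e)
  qed
qed

subsection \<open>Volume in lattice coordinates\<close>

lemma measurable_affine_lborel_on:
  "(\<lambda>c. \<lambda>i\<in>I. a i + s * c i) \<in> lborel_on I \<rightarrow>\<^sub>M lborel_on I" for a :: "'i \<Rightarrow> real"
  by (rule measurable_restrict) (simp add: measurable_component_lborel_on)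

text \<open>One coordinate at a time. It serves for translations, for the reflection in the Haar
  argument and for dilating slices of the cone.\<close>

lemma nn_integral_lborel_on_affine:
  fixes s :: real and a :: "'i \<Rightarrow> real"
  assumes "finite I" "s \<noteq> 0" "F \<in> borel_measurable (lborel_on I)"
  shows "(\<integral>\<^sup>+c. F c \<partial>lborel_on I) =
    ennreal (\<bar>s\<bar> ^ card I) * (\<integral>\<^sup>+c. F (\<lambda>i\<in>I. a i + s * c i) \<partial>lborel_on I)"
  using assms
proof (induction I arbitrary: F rule: finite_induct)
  case empty
  then show ?case by (simp add: PiM_empty nn_integral_count_space_finite restrict_def)
next
  case (insert k I)
  note F[measurable] = insert.prems(2)
  note s = insert.prems(1)
  define H where "H x = (\<integral>\<^sup>+y. F (x(k := a k + s * y)) \<partial>lborel)" for x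
  have upd: "(\<lambda>(x, y). x(k := a k + s * y)) \<in> lborel_on I \<Otimes>\<^sub>M lborel \<rightarrow>\<^sub>M lborel_on (insert k I)"
    unfolding split_beta' by (rule measurable_fun_upd[where J = I]) auto
  then have H: "H \<in> borel_measurable (lborel_on I)"
    unfolding H_def
    by (intro sigma_finite_measure.borel_measurable_nn_integral) (auto simp: split_beta' intro: measurable_compose[OF _ F] sigma_finite_lborel)
  have inner: "(\<integral>\<^sup>+y. F (x(k := y)) \<partial>lborel) = \<bar>s\<bar> * H x" if "x \<in> space (lborel_on I)" for x
  proof -
    have "(\<lambda>y. F (x(k := y))) \<in> borel_measurable lborel"
      by (rule measurable_compose[OF measurable_component_update[OF that insert.hyps(2)] F])
    then have "(\<lambda>y. F (x(k := y))) \<in> borel_measurable borel"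
      by (simp only: measurable_lborel2)
    from nn_integral_real_affine[OF this s, of "a k"] show ?thesis by (simp add: H_def)
  qed
  have "(\<integral>\<^sup>+c. F c \<partial>lborel_on (insert k I)) = (\<integral>\<^sup>+x. \<bar>s\<bar> * H x \<partial>lborel_on I)"
    using lborel_product.product_nn_integral_insert[OF insert.hyps F] by (simp only:) (rule nn_integral_cong, rule inner)
  also have "\<dots> = \<bar>s\<bar> * (\<bar>s\<bar> ^ card I * (\<integral>\<^sup>+x. H (\<lambda>i\<in>I. a i + s * x i) \<partial>lborel_on I))"
    by (simp only: nn_integral_cmult[OF H] insert.IH[OF s H])
  also have "(\<integral>\<^sup>+x. H (\<lambda>i\<in>I. a i + s * x i) \<partial>lborel_on I) =
      (\<integral>\<^sup>+x. \<integral>\<^sup>+y. F (\<lambda>i\<in>insert k I. a i + s * (x(k := y)) i) \<partial>lborel \<partial>lborel_on I)"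
  proof -
    have "(\<lambda>i\<in>I. a i + s * x i)(k := a k + s * y) = (\<lambda>i\<in>insert k I. a i + s * (x(k := y)) i)"
      for x :: "'i \<Rightarrow> real" and y
      using insert.hyps by (auto simp: fun_eq_iff)
    then show ?thesis by (simp only: H_def)
  qed
  also have "\<dots> = (\<integral>\<^sup>+c. F (\<lambda>i\<in>insert k I. a i + s * c i) \<partial>lborel_on (insert k I))"
    by (rule lborel_product.product_nn_integral_insert[OF insert.hyps
        measurable_compose[OF measurable_affine_lborel_on F], symmetric])
  finally have "(\<integral>\<^sup>+c. F c \<partial>lborel_on (insert k I)) = \<bar>s\<bar> * (\<bar>s\<bar> ^ card I *
      (\<integral>\<^sup>+c. F (\<lambda>i\<in>insert k I. a i + s * c i) \<partial>lborel_on (insert k I)))" .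
  moreover have "ennreal (\<bar>s\<bar> ^ card (insert k I)) = ennreal \<bar>s\<bar> * ennreal (\<bar>s\<bar> ^ card I)"
    using insert.hyps by (simp add: ennreal_mult)
  ultimately show ?case by (simp only: mult.assoc)
qed

section \<open>Lattice bases as indexed families, and independence of the basis\<close>

definition lincomb :: "'i set \<Rightarrow> ('i \<Rightarrow> 'a::real_vector) \<Rightarrow> ('i \<Rightarrow> real) \<Rightarrow> 'a" where
  "lincomb I g c = (\<Sum>i\<in>I. c i *\<^sub>R g i)"

text \<open>An arbitrary index type lets the explicit basis be indexed by vertices, so that its
  coefficients are coordinates of the cone.\<close>

definition lattice_family :: "'a::real_vector set \<Rightarrow> 'i set \<Rightarrow> ('i \<Rightarrow> 'a) \<Rightarrow> bool" where
  "lattice_family L I g \<longleftrightarrow> finite I \<and> (\<forall>c. lincomb I g c = 0 \<longrightarrow> (\<forall>i\<in>I. c i = 0)) \<and>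
     L = {lincomb I g (\<lambda>i. of_int (c i)) | c. True}"

lemma lattice_basis_family: "lattice_basis L B \<Longrightarrow> lattice_family L B (\<lambda>b. b)"
  unfolding lattice_basis_def lattice_family_def lincomb_def
  by (auto intro: independentD[OF _ _ subset_refl])

lemma lincomb_cong: "(\<And>i. i \<in> I \<Longrightarrow> c i = d i) \<Longrightarrow> lincomb I g c = lincomb I g d"
  unfolding lincomb_def by (intro sum.cong) auto

lemma lincomb_restrict [simp]: "lincomb I g (restrict c I) = lincomb I g c"
  by (rule lincomb_cong) simp

lemma lincomb_affine: "lincomb I g (\<lambda>i. a i + s * c i) = lincomb I g a + s *\<^sub>R lincomb I g c"
  by (simp add: lincomb_def scaleR_add_left sum.distrib scaleR_sum_right)

lemma measurable_lincomb [measurable]: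
  "lincomb I g \<in> borel_measurable (lborel_on I)" for g :: "'i \<Rightarrow> 'a::euclidean_space"
  unfolding lincomb_def
  by (intro borel_measurable_sum borel_measurable_scaleR measurable_component_lborel_on) auto

lemma lattice_family_eqD:
  assumes "lattice_family L I g" "lincomb I g c = lincomb I g d" "i \<in> I"
  shows "c i = d i"
proof -
  have "lincomb I g (\<lambda>i. c i + - 1 * d i) = 0"
    unfolding lincomb_affine using assms(2) by simp
  then show ?thesis using assms(1,3) by (force simp: lattice_family_def)
qed

lemma lattice_family_memI: "lattice_family L I g \<Longrightarrow> lincomb I g (\<lambda>i. of_int (c i)) \<in> L"
  by (auto simp: lattice_family_def)

lemma lattice_family_memE:
  assumes "lattice_family L I g" "x \<in> L"
  obtains c where "x = lincomb I g (\<lambda>i. of_int (c i))"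
  using assms by (auto simp: lattice_family_def)

lemma lattice_family_mem:
  assumes "lattice_family L I g" "i \<in> I"
  shows "g i \<in> L"
proof -
  have "lincomb I g (\<lambda>k. of_int (of_bool (k = i))) = g i"
    using assms by (simp add: lincomb_def lattice_family_def of_bool_def if_distrib[of of_int] if_distrib[of "\<lambda>u. u *\<^sub>R _"] cong: if_cong)
  then show ?thesis using lattice_family_memI[OF assms(1)] by metis
qed

text \<open>Each \<open>g i\<close> lies in \<open>L\<close> and is thus an integer combination of
  \<open>h\<close>, so the real span of \<open>g\<close> lies in that of \<open>h\<close>.\<close>

lemma lattice_family_change:
  assumes "lattice_family L I g" "lattice_family L J h"
  shows "\<exists>d. lincomb I g c = lincomb J h d"
proof -
  have "\<exists>n. g i = lincomb J h n" if i: "i \<in> I" for i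
  proof -
    obtain c where "g i = lincomb J h (\<lambda>j. of_int (c j))"
      using lattice_family_memE[OF assms(2) lattice_family_mem[OF assms(1) i]] .
    then show ?thesis by blast
  qed
  then obtain n where n: "\<And>i. i \<in> I \<Longrightarrow> g i = lincomb J h (n i)" by metis
  have "lincomb I g c = (\<Sum>i\<in>I. \<Sum>j\<in>J. (c i * n i j) *\<^sub>R h j)"
    unfolding lincomb_def[of I] by (intro sum.cong) (simp_all add: n lincomb_def scaleR_sum_right)
  also have "\<dots> = lincomb J h (\<lambda>j. \<Sum>i\<in>I. c i * n i j)"
    unfolding lincomb_def by (subst sum.swap) (simp add: scaleR_sum_left)
  finally show ?thesis by blast
qed

lemma nn_integral_lincomb_affine:
  fixes g :: "'i \<Rightarrow> 'a::euclidean_space"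
  assumes "finite I" "s \<noteq> 0" and [measurable]: "f \<in> borel_measurable borel"
  shows "(\<integral>\<^sup>+c. f (lincomb I g c) \<partial>lborel_on I) =
    ennreal (\<bar>s\<bar> ^ card I) * (\<integral>\<^sup>+c. f (lincomb I g a + s *\<^sub>R lincomb I g c) \<partial>lborel_on I)"
  using nn_integral_lborel_on_affine[OF assms(1,2), of "\<lambda>c. f (lincomb I g c)" a]
  by (simp add: lincomb_affine)

text \<open>
  Uniqueness of Haar measure: both sides equal the double integral of \<open>p(x) q(y - x)\<close>, by the
  translation \<open>y \<mapsto> y + x\<close> and by the reflection \<open>x \<mapsto> y - x\<close>.
\<close>
lemma lattice_family_haar:
  fixes g :: "'i \<Rightarrow> 'a::euclidean_space" and h :: "'j \<Rightarrow> 'a"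
  assumes I: "lattice_family L I g" and J: "lattice_family L J h"
    and [measurable]: "p \<in> borel_measurable borel" "q \<in> borel_measurable borel"
  shows "(\<integral>\<^sup>+c. p (lincomb I g c) \<partial>lborel_on I) * (\<integral>\<^sup>+d. q (lincomb J h d) \<partial>lborel_on J) =
    (\<integral>\<^sup>+c. q (lincomb I g c) \<partial>lborel_on I) * (\<integral>\<^sup>+d. p (lincomb J h d) \<partial>lborel_on J)"
proof -
  have fin: "finite I" "finite J" using I J by (auto simp: lattice_family_def)
  interpret IJ: pair_sigma_finite "lborel_on I" "lborel_on J"
    by (intro pair_sigma_finite.intro lborel_product.sigma_finite fin)
  let ?g = "lincomb I g" and ?h = "lincomb J h"
  have shift: "(\<integral>\<^sup>+d. q (?h d) \<partial>lborel_on J) = (\<integral>\<^sup>+d. q (?h d - ?g c) \<partial>lborel_on J)" for c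
  proof -
    obtain b where b: "- ?g c = ?h b"
      using lattice_family_change[OF I J, of "\<lambda>i. - c i"]
      by (auto simp: lincomb_def sum_negf)
    show ?thesis
      using nn_integral_lincomb_affine[OF fin(2), of 1 q h b] by (simp flip: b)
  qed
  have shift': "(\<integral>\<^sup>+d. p (?h d - ?g c) \<partial>lborel_on J) = (\<integral>\<^sup>+d. p (?h d) \<partial>lborel_on J)" for c
  proof -
    obtain b where b: "- ?g c = ?h b"
      using lattice_family_change[OF I J, of "\<lambda>i. - c i"]
      by (auto simp: lincomb_def sum_negf)
    show ?thesis
      using nn_integral_lincomb_affine[OF fin(2), of 1 p h b] by (simp flip: b)
  qed
  have reflect: "(\<integral>\<^sup>+c. p (?g c) * q (?h d - ?g c) \<partial>lborel_on I) =
      (\<integral>\<^sup>+c. p (?h d - ?g c) * q (?g c) \<partial>lborel_on I)" for d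
  proof -
    obtain b where "?h d = ?g b" using lattice_family_change[OF J I] by blast
    then show ?thesis
      using nn_integral_lincomb_affine[OF fin(1), of "-1" "\<lambda>x. p x * q (?h d - x)" g b] by simp
  qed
  have "(\<integral>\<^sup>+c. p (?g c) \<partial>lborel_on I) * (\<integral>\<^sup>+d. q (?h d) \<partial>lborel_on J) =
      (\<integral>\<^sup>+c. p (?g c) * (\<integral>\<^sup>+d. q (?h d) \<partial>lborel_on J) \<partial>lborel_on I)"
    by (simp add: nn_integral_multc)
  also have "\<dots> = (\<integral>\<^sup>+c. \<integral>\<^sup>+d. p (?g c) * q (?h d - ?g c) \<partial>lborel_on J \<partial>lborel_on I)"
    by (simp add: nn_integral_cmult flip: shift)
  also have "\<dots> = (\<integral>\<^sup>+d. \<integral>\<^sup>+c. p (?g c) * q (?h d - ?g c) \<partial>lborel_on I \<partial>lborel_on J)"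
    by (rule IJ.Fubini'[symmetric]) measurable
  also have "\<dots> = (\<integral>\<^sup>+d. \<integral>\<^sup>+c. p (?h d - ?g c) * q (?g c) \<partial>lborel_on I \<partial>lborel_on J)"
    by (simp only: reflect)
  also have "\<dots> = (\<integral>\<^sup>+c. \<integral>\<^sup>+d. p (?h d - ?g c) * q (?g c) \<partial>lborel_on J \<partial>lborel_on I)"
    by (rule IJ.Fubini') measurable
  also have "\<dots> = (\<integral>\<^sup>+c. (\<integral>\<^sup>+d. p (?h d) \<partial>lborel_on J) * q (?g c) \<partial>lborel_on I)"
    by (simp add: nn_integral_multc shift')
  also have "\<dots> = (\<integral>\<^sup>+c. q (?g c) \<partial>lborel_on I) * (\<integral>\<^sup>+d. p (?h d) \<partial>lborel_on J)"
    by (simp add: nn_integral_multc mult.commute)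
  finally show ?thesis .
qed

text \<open>Half open, so that its integer translates tile without overlap.\<close>

definition unit_box :: "'i set \<Rightarrow> ('i \<Rightarrow> real) set" where
  "unit_box I = {c. \<forall>i\<in>I. 0 \<le> c i \<and> c i < 1}"

lemma nn_integral_unit_box:
  assumes "finite I"
  shows "(\<integral>\<^sup>+c. indicator (unit_box I) c \<partial>lborel_on I) = 1"
proof -
  have "indicator (unit_box I) c = (\<Prod>i\<in>I. indicator {0..<1} (c i) :: ennreal)" for c
    using assms by (auto simp: unit_box_def indicator_def prod_zero_iff intro!: prod.neutral)
  then have "(\<integral>\<^sup>+c. indicator (unit_box I) c \<partial>lborel_on I) =
      (\<Prod>i\<in>I. \<integral>\<^sup>+t. indicator {0..<1} (t :: real) \<partial>lborel)"
    by (simp only:) (rule lborel_product.product_nn_integral_prod, use assms in auto)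
  then show ?thesis by simp
qed

lemma measurable_unit_box:
  assumes "finite I"
  shows "Measurable.pred (lborel_on I) (\<lambda>c. (\<lambda>i\<in>I. a i + s * c i) \<in> unit_box I)"
proof -
  have "Measurable.pred (lborel_on I) (\<lambda>c. \<forall>i\<in>I. 0 \<le> a i + s * c i \<and> a i + s * c i < 1)"
    using assms measurable_component_lborel_on[of _ I, measurable]
    by (intro pred_intros_finite) auto
  then show ?thesis by (simp add: unit_box_def)
qed

text \<open>The coordinate functional on the span extends linearly to the whole space, where linear
  maps are continuous and hence Borel.\<close>

lemma lattice_family_coordinate:
  fixes g :: "'i \<Rightarrow> 'a::euclidean_space"
  assumes "lattice_family L I g" "i \<in> I"
  shows "\<exists>\<phi> :: 'a \<Rightarrow> real. \<phi> \<in> borel_measurable borel \<and> (\<forall>c. \<phi> (lincomb I g c) = c i)"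
proof -
  have fin: "finite I" using assms by (simp add: lattice_family_def)
  have inj: "inj_on g I"
  proof (rule inj_onI, rule ccontr)
    fix k l assume kl: "k \<in> I" "l \<in> I" "g k = g l" "k \<noteq> l"
    have "lincomb I g (\<lambda>x. of_bool (x = m)) = g m" if "m \<in> I" for m
      using that fin by (simp add: lincomb_def of_bool_def if_distrib[of "\<lambda>u. u *\<^sub>R _"] cong: if_cong)
    then have "lincomb I g (\<lambda>x. of_bool (x = k)) = lincomb I g (\<lambda>x. of_bool (x = l))"
      using kl by simp
    from lattice_family_eqD[OF assms(1) this kl(1)] kl(4) show False by simp
  qed
  have "independent (g ` I)"
  proof (rule independent_if_scalars_zero)
    fix u x assume "(\<Sum>x\<in>g ` I. u x *\<^sub>R x) = 0" "x \<in> g ` I"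
    then show "u x = 0"
      using assms(1) inj by (auto simp: sum.reindex lattice_family_def lincomb_def)
  qed (use fin in auto)
  from linear_independent_extend[OF this, of "\<lambda>x. of_bool (x = g i) :: real"]
  obtain \<phi> :: "'a \<Rightarrow> real" where \<phi>: "linear \<phi>" "\<forall>x\<in>g ` I. \<phi> x = of_bool (x = g i)" by blast
  have "\<phi> (lincomb I g c) = c i" for c
  proof -
    have "\<phi> (lincomb I g c) = (\<Sum>k\<in>I. c k * \<phi> (g k))"
      using \<phi>(1) by (simp add: lincomb_def linear_sum linear_cmul)
    also have "\<dots> = (\<Sum>k\<in>I. if k = i then c k else 0)"
      using \<phi>(2) inj assms(2) by (intro sum.cong) (auto simp: inj_on_eq_iff)
    finally show ?thesis using fin assms(2) by simp
  qed
  moreover have "\<phi> \<in> borel_measurable borel"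
    using \<phi>(1) by (intro borel_measurable_continuous_onI linear_continuous_on linear_conv_bounded_linear[THEN iffD1])
  ultimately show ?thesis by blast
qed

text \<open>
  The witness is the indicator of the fundamental parallelepiped of the second basis: its lattice
  translates cover every point once, so it can be cut up into the one of the first basis.
\<close>
lemma lattice_family_fundamental_domain:
  fixes g :: "'i \<Rightarrow> 'a::euclidean_space" and h :: "'j \<Rightarrow> 'a"
  assumes I: "lattice_family L I g" and J: "lattice_family L J h"
  shows "\<exists>f\<in>borel_measurable borel. (\<integral>\<^sup>+c. f (lincomb I g c) \<partial>lborel_on I) = 1 \<and>
    (\<integral>\<^sup>+d. f (lincomb J h d) \<partial>lborel_on J) = 1"
proof -
  have fin: "finite I" "finite J" using I J by (auto simp: lattice_family_def)
  let ?g = "lincomb I g" and ?h = "lincomb J h"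
  obtain \<phi> where \<phi> [measurable]: "\<And>j. j \<in> J \<Longrightarrow> \<phi> j \<in> borel_measurable borel"
    and \<phi>h: "\<And>j d. j \<in> J \<Longrightarrow> \<phi> j (?h d) = d j"
    using lattice_family_coordinate[OF J] by metis
  define f :: "'a \<Rightarrow> ennreal" where "f x = of_bool (\<forall>j\<in>J. 0 \<le> \<phi> j x \<and> \<phi> j x < 1)" for x
  have "Measurable.pred borel (\<lambda>x. \<forall>j\<in>J. 0 \<le> \<phi> j x \<and> \<phi> j x < 1)"
    using fin by (intro pred_intros_finite) auto
  then have f [measurable]: "f \<in> borel_measurable borel"
    unfolding f_def of_bool_def by measurable
  have fh: "f (?h d) = indicator (unit_box J) d" for d
    by (auto simp: f_def \<phi>h unit_box_def indicator_def)
  \<comment> \<open>Extensional functions, so that each lattice vector has exactly one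
    index.\<close>
  define Z where "Z = (\<Pi>\<^sub>E i\<in>I. (UNIV :: int set))"
  have Z: "countable Z" unfolding Z_def using fin by (intro countable_PiE) auto
  have count1: "(\<integral>\<^sup>+n. indicator {n0} n \<partial>count_space Z) = (1 :: ennreal)" if "n0 \<in> Z" for n0
    using that by (subst nn_integral_indicator) (auto simp: emeasure_count_space)
  have tile: "(\<integral>\<^sup>+n. indicator (unit_box I) (\<lambda>i\<in>I. - of_int (n i) + 1 * c i) \<partial>count_space Z) = (1 :: ennreal)" for c
  proof -
    have "(\<lambda>i\<in>I. - of_int (n i) + 1 * c i) \<in> unit_box I \<longleftrightarrow> n = (\<lambda>i\<in>I. \<lfloor>c i\<rfloor>)" if "n \<in> Z" for n
    proof -
      have "(\<lambda>i\<in>I. - of_int (n i) + 1 * c i) \<in> unit_box I \<longleftrightarrow> (\<forall>i\<in>I. n i = \<lfloor>c i\<rfloor>)"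
      proof -
        have "(m = \<lfloor>x\<rfloor>) = (0 \<le> - of_int m + 1 * x \<and> - of_int m + 1 * x < 1)" for m :: int and x :: real
          by linarith
        then show ?thesis by (simp add: unit_box_def)
      qed
      also have "\<dots> \<longleftrightarrow> n = (\<lambda>i\<in>I. \<lfloor>c i\<rfloor>)"
        using that by (auto simp: Z_def PiE_def extensional_def fun_eq_iff)
      finally show ?thesis .
    qed
    then have "(\<integral>\<^sup>+n. indicator (unit_box I) (\<lambda>i\<in>I. - of_int (n i) + 1 * c i) \<partial>count_space Z) =
        (\<integral>\<^sup>+n. (indicator {\<lambda>i\<in>I. \<lfloor>c i\<rfloor>} n :: ennreal) \<partial>count_space Z)"
      by (intro nn_integral_cong) (simp add: indicator_def)
    also have "\<dots> = 1" by (rule count1) (auto simp: Z_def)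
    finally show ?thesis .
  qed
  \<comment> \<open>Exactly one lattice translation moves a point of the span into the
    parallelepiped of \<open>h\<close>: it subtracts the floors of the
    \<open>h\<close>-coordinates.\<close>
  have cover: "(\<integral>\<^sup>+n. f (?g (\<lambda>i. of_int (n i)) + ?g c) \<partial>count_space Z) = 1" for c
  proof -
    obtain b where b: "?g c = ?h b" using lattice_family_change[OF I J] by blast
    obtain n1 where n1: "?h (\<lambda>j. of_int (- \<lfloor>b j\<rfloor>)) = ?g (\<lambda>i. of_int (n1 i))"
      using lattice_family_memE[OF I lattice_family_memI[OF J]] .
    define n0 where "n0 = restrict n1 I"
    have n0: "?g (\<lambda>i. of_int (n0 i)) = ?h (\<lambda>j. of_int (- \<lfloor>b j\<rfloor>))" "n0 \<in> Z"
      using n1 by (auto simp: n0_def Z_def cong: lincomb_cong)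
    have "f (?g (\<lambda>i. of_int (n i)) + ?g c) = indicator {n0} n" if n: "n \<in> Z" for n
    proof -
      obtain k where k: "?g (\<lambda>i. of_int (n i)) = ?h (\<lambda>j. of_int (k j))"
        using lattice_family_memE[OF J lattice_family_memI[OF I]] .
      have "?g (\<lambda>i. of_int (n i)) + ?g c = ?h (\<lambda>j. of_int (k j) + 1 * b j)"
        unfolding k b lincomb_affine by simp
      then have "f (?g (\<lambda>i. of_int (n i)) + ?g c) = f (?h (\<lambda>j. of_int (k j) + 1 * b j))" by simp
      also have "\<dots> = of_bool (\<forall>j\<in>J. k j = - \<lfloor>b j\<rfloor>)"
      proof -
        have "(m = - \<lfloor>x\<rfloor>) = (0 \<le> of_int m + 1 * x \<and> of_int m + 1 * x < 1)" for m :: int and x :: real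
          by linarith
        then show ?thesis by (simp add: fh unit_box_def indicator_def)
      qed
      also have "(\<forall>j\<in>J. k j = - \<lfloor>b j\<rfloor>) \<longleftrightarrow> n = n0"
      proof
        assume "\<forall>j\<in>J. k j = - \<lfloor>b j\<rfloor>"
        then have "?g (\<lambda>i. of_int (n i)) = ?g (\<lambda>i. of_int (n0 i))"
          unfolding k n0 by (intro lincomb_cong) auto
        then have "\<forall>i\<in>I. n i = n0 i" using lattice_family_eqD[OF I] by fastforce
        then show "n = n0" using n n0(2) by (auto simp: Z_def intro: PiE_ext)
      next
        assume "n = n0"
        then have "?h (\<lambda>j. of_int (k j)) = ?h (\<lambda>j. of_int (- \<lfloor>b j\<rfloor>))" using k n0 by simp
        then show "\<forall>j\<in>J. k j = - \<lfloor>b j\<rfloor>" using lattice_family_eqD[OF J] by fastforce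
      qed
      finally show ?thesis by (simp add: indicator_def)
    qed
    then have "(\<integral>\<^sup>+n. f (?g (\<lambda>i. of_int (n i)) + ?g c) \<partial>count_space Z) =
        (\<integral>\<^sup>+n. indicator {n0} n \<partial>count_space Z)"
      by (intro nn_integral_cong) simp
    then show ?thesis using count1[OF n0(2)] by simp
  qed
  have box [measurable]: "Measurable.pred (lborel_on I) (\<lambda>c. (\<lambda>i\<in>I. a i + s * c i) \<in> unit_box I)" for a s
    by (rule measurable_unit_box[OF fin(1)])
  have shift: "(\<integral>\<^sup>+c. f (?g c) * indicator (unit_box I) (\<lambda>i\<in>I. - of_int (n i) + 1 * c i) \<partial>lborel_on I) =
      (\<integral>\<^sup>+c. f (?g (\<lambda>i. of_int (n i)) + ?g c) * indicator (unit_box I) c \<partial>lborel_on I)" for n :: "'i \<Rightarrow> int"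
  proof -
    have m: "(\<lambda>c. f (?g c) * indicator (unit_box I) (\<lambda>i\<in>I. - of_int (n i) + 1 * c i))
        \<in> borel_measurable (lborel_on I)" by measurable
    have "(\<lambda>i\<in>I. - of_int (n i) + 1 * (\<lambda>i\<in>I. of_int (n i) + 1 * c i) i) \<in> unit_box I \<longleftrightarrow> c \<in> unit_box I" for c
      by (simp add: unit_box_def)
    then show ?thesis
      using nn_integral_lborel_on_affine[OF fin(1) _ m, of 1 "\<lambda>i. of_int (n i)"]
        lincomb_affine[of I g "\<lambda>i. of_int (n i)" 1]
      by (simp add: indicator_def)
  qed
  have box1: "Measurable.pred (lborel_on I) (\<lambda>c. c \<in> unit_box I)"
    using box[of "\<lambda>_. 0" 1] by (simp add: unit_box_def)
  note box1 [measurable]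
  \<comment> \<open>Cut the integral into unit boxes of the \<open>g\<close>-coordinates by
    \<open>tile\<close>, translate each to the standard box, and collect the translates by
    \<open>cover\<close>.\<close>
  have "(\<integral>\<^sup>+c. f (?g c) \<partial>lborel_on I) = (\<integral>\<^sup>+c. \<integral>\<^sup>+n. f (?g c) *
      indicator (unit_box I) (\<lambda>i\<in>I. - of_int (n i) + 1 * c i) \<partial>count_space Z \<partial>lborel_on I)"
    by (simp only: nn_integral_cmult[OF borel_measurable_count_space] tile mult_1_right)
  also have "\<dots> = (\<integral>\<^sup>+n. \<integral>\<^sup>+c. f (?g c) *
      indicator (unit_box I) (\<lambda>i\<in>I. - of_int (n i) + 1 * c i) \<partial>lborel_on I \<partial>count_space Z)"
    by (rule nn_integral_count_space_nn_integral[OF Z]) measurable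
  also have "\<dots> = (\<integral>\<^sup>+n. \<integral>\<^sup>+c. f (?g (\<lambda>i. of_int (n i)) + ?g c) * indicator (unit_box I) c \<partial>lborel_on I \<partial>count_space Z)"
    by (simp only: shift)
  also have "\<dots> = (\<integral>\<^sup>+c. \<integral>\<^sup>+n. f (?g (\<lambda>i. of_int (n i)) + ?g c) * indicator (unit_box I) c \<partial>count_space Z \<partial>lborel_on I)"
    by (rule nn_integral_count_space_nn_integral[OF Z, symmetric]) measurable
  also have "\<dots> = 1"
    by (simp only: nn_integral_multc[OF borel_measurable_count_space] cover mult_1_left nn_integral_unit_box[OF fin(1)])
  finally have "(\<integral>\<^sup>+c. f (?g c) \<partial>lborel_on I) = 1" .
  moreover have "(\<integral>\<^sup>+d. f (?h d) \<partial>lborel_on J) = 1"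
    unfolding fh by (rule nn_integral_unit_box[OF fin(2)])
  ultimately show ?thesis using f by blast
qed

text \<open>By \<open>lattice_family_haar\<close> the two integrals are proportional; the
  fundamental domain fixes the constant as \<open>1\<close>.\<close>

lemma nn_integral_lattice_family_eq:
  fixes g :: "'i \<Rightarrow> 'a::euclidean_space" and h :: "'j \<Rightarrow> 'a"
  assumes I: "lattice_family L I g" and J: "lattice_family L J h" and q: "q \<in> borel_measurable borel"
  shows "(\<integral>\<^sup>+c. q (lincomb I g c) \<partial>lborel_on I) = (\<integral>\<^sup>+d. q (lincomb J h d) \<partial>lborel_on J)"
proof -
  obtain f where "f \<in> borel_measurable borel" "(\<integral>\<^sup>+c. f (lincomb I g c) \<partial>lborel_on I) = 1"
    "(\<integral>\<^sup>+d. f (lincomb J h d) \<partial>lborel_on J) = 1"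
    using lattice_family_fundamental_domain[OF I J] by blast
  then show ?thesis using lattice_family_haar[OF I J _ q, of f] by simp
qed

text \<open>Lets a convenient origin and basis replace the ones picked by \<open>SOME\<close> in
  \<open>root_volume\<close>.\<close>

lemma coord_volume_eq_nn_integral:
  fixes S :: "'a::euclidean_space set"
  assumes B: "lattice_basis L B" and I: "lattice_family L I g" and S: "S \<in> sets borel"
  shows "coord_volume (p + lincomb I g a) B S =
    enn2real (\<integral>\<^sup>+c. indicator S (p + lincomb I g c) \<partial>lborel_on I)"
proof -
  have fin: "finite I" using I by (simp add: lattice_family_def)
  let ?p = "p + lincomb I g a"
  have [measurable]: "(\<lambda>x. indicator S (p + x) :: ennreal) \<in> borel_measurable borel"
    "(\<lambda>x. indicator S (?p + x) :: ennreal) \<in> borel_measurable borel"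
    using S by measurable
  have m: "Measurable.pred (lborel_on B) (\<lambda>c. ?p + lincomb B (\<lambda>b. b) c \<in> S)"
    using S by measurable
  have "{c \<in> B \<rightarrow>\<^sub>E UNIV. ?p + (\<Sum>b\<in>B. c b *\<^sub>R b) \<in> S} =
      {c \<in> space (lborel_on B). ?p + lincomb B (\<lambda>b. b) c \<in> S}"
    by (simp add: space_PiM lincomb_def)
  then have "coord_volume ?p B S = enn2real (\<integral>\<^sup>+c. indicator {c \<in> space (lborel_on B). ?p + lincomb B (\<lambda>b. b) c \<in> S} c \<partial>lborel_on B)"
    using m by (simp add: coord_volume_def measure_def pred_def)
  also have "\<dots> = enn2real (\<integral>\<^sup>+c. indicator S (?p + lincomb B (\<lambda>b. b) c) \<partial>lborel_on B)"
    by (intro arg_cong[of _ _ enn2real] nn_integral_cong) (simp add: indicator_def)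
  also have "\<dots> = enn2real (\<integral>\<^sup>+c. indicator S (?p + lincomb I g c) \<partial>lborel_on I)"
    by (subst nn_integral_lattice_family_eq[OF lattice_basis_family[OF B] I]) simp_all
  also have "\<dots> = enn2real (\<integral>\<^sup>+c. indicator S (p + lincomb I g c) \<partial>lborel_on I)"
    using nn_integral_lincomb_affine[OF fin, of 1 "\<lambda>x. indicator S (p + x)" g a]
    by (simp add: add.assoc)
  finally show ?thesis .
qed


subsection \<open>Root polytopes and generalized permutohedra\<close>

definition bip_edges :: "('m \<times> 'n) set \<Rightarrow> (('m + 'n) \<times> ('m + 'n)) set" where
  "bip_edges G = (\<lambda>(i, j). (Inl i, Inr j)) ` G"

lemma bip_edges_subset: "bip_edges G \<subseteq> range Inl \<times> - range Inl"
  by (auto simp: bip_edges_def)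

lemma up_closed_bip_edges:
  "up_closed (bip_edges G) UNIV S \<longleftrightarrow> (\<forall>(i, j)\<in>G. Inr j \<in> S \<longrightarrow> Inl i \<in> S)"
  by (auto simp: up_closed_def bip_edges_def)

lemma Inl_Inr_mem_bip_edges: "(Inl i, Inr j) \<in> bip_edges G \<longleftrightarrow> (i, j) \<in> G"
  by (force simp: bip_edges_def)

lemma sum_incidence:
  fixes f :: "'m::finite \<Rightarrow> 'n::finite \<Rightarrow> real"
  shows "(\<Sum>i\<in>UNIV. \<Sum>j\<in>UNIV. f i j * (of_bool (k = Inl i) - of_bool (k = Inr j))) =
    (case k of Inl i \<Rightarrow> \<Sum>j\<in>UNIV. f i j | Inr j \<Rightarrow> - (\<Sum>i\<in>UNIV. f i j))"
proof (cases k)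
  case (Inl l)
  have "(\<Sum>j\<in>UNIV. f i j * (of_bool (k = Inl i) - of_bool (k = Inr j))) =
      (if i = l then \<Sum>j\<in>UNIV. f i j else 0)" for i
    using Inl by auto
  then show ?thesis using Inl by simp
next
  case (Inr l)
  have "f i j * (of_bool (k = Inl i) - of_bool (k = Inr j)) = (if j = l then - f i j else 0)" for i j
    using Inr by auto
  then show ?thesis using Inr by (simp add: sum_negf)
qed

lemma sum_Plus:
  fixes f :: "'m::finite + 'n::finite \<Rightarrow> real"
  shows "sum f S = (\<Sum>i\<in>UNIV. of_bool (Inl i \<in> S) * f (Inl i)) + (\<Sum>j\<in>UNIV. of_bool (Inr j \<in> S) * f (Inr j))"
proof -
  have "sum g UNIV = (\<Sum>i\<in>UNIV. g (Inl i)) + (\<Sum>j\<in>UNIV. g (Inr j))" for g :: "'m + 'n \<Rightarrow> real"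
    by (simp add: UNIV_Plus_UNIV[symmetric] sum.Plus del: UNIV_Plus_UNIV)
  note this[of "\<lambda>k. of_bool (k \<in> S) * f k"]
  moreover have "sum f S = (\<Sum>k\<in>UNIV. of_bool (k \<in> S) * f k)"
    by (rule sum.mono_neutral_cong_left) auto
  ultimately show ?thesis by metis
qed

lemma edge_flow_bip_edges:
  fixes G :: "('m::finite \<times> 'n::finite) set"
  assumes "\<And>e. e \<notin> bip_edges G \<Longrightarrow> f e = 0"
  shows "edge_flow (bip_edges G) f k =
    (\<Sum>i\<in>UNIV. \<Sum>j\<in>UNIV. f (Inl i, Inr j) * (of_bool (k = Inl i) - of_bool (k = Inr j)))"
proof -
  have "edge_flow (bip_edges G) f k =
      (\<Sum>(i, j)\<in>G. f (Inl i, Inr j) * (of_bool (k = Inl i) - of_bool (k = Inr j)))"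
    unfolding edge_flow_def bip_edges_def
    by (subst sum.reindex) (auto simp: inj_on_def split_beta')
  also have "\<dots> = (\<Sum>(i, j)\<in>UNIV. f (Inl i, Inr j) * (of_bool (k = Inl i) - of_bool (k = Inr j)))"
  proof (rule sum.mono_neutral_left)
    have "f (Inl i, Inr j) = 0" if "(i, j) \<notin> G" for i j
      using that assms by (simp add: Inl_Inr_mem_bip_edges)
    then show "\<forall>e\<in>UNIV - G.
        (case e of (i, j) \<Rightarrow> f (Inl i, Inr j) * (of_bool (k = Inl i) - of_bool (k = Inr j))) = 0"
      by (simp add: split_beta')
  qed auto
  finally show ?thesis by (simp add: sum.cartesian_product)
qed

text \<open>Matrix form of \<open>cut_cone_edge_flow\<close>. The entries become convex coefficients
  for the root polytope, and the rows become points of the simplices for the permutohedron.\<close>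

lemma cut_cone_bip_flow:
  fixes G :: "('m::finite \<times> 'n::finite) set"
  assumes "z \<in> cut_cone (bip_edges G) UNIV"
  obtains f :: "'m \<Rightarrow> 'n \<Rightarrow> real" where "\<And>i j. 0 \<le> f i j" "\<And>i j. (i, j) \<notin> G \<Longrightarrow> f i j = 0"
    "\<And>i. z (Inl i) = (\<Sum>j\<in>UNIV. f i j)" "\<And>j. z (Inr j) = - (\<Sum>i\<in>UNIV. f i j)"
proof -
  obtain f where f: "\<forall>e. 0 \<le> f e" "\<forall>e. e \<notin> bip_edges G \<inter> UNIV \<times> UNIV \<longrightarrow> f e = 0"
    "\<forall>k\<in>UNIV. z k = edge_flow (bip_edges G) f k"
    using cut_cone_edge_flow[OF _ _ assms] by auto
  have off: "f e = 0" if "e \<notin> bip_edges G" for e using f(2) that by (metis IntD1)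
  have z: "z k = (case k of Inl i \<Rightarrow> \<Sum>j\<in>UNIV. f (Inl i, Inr j) | Inr j \<Rightarrow> - (\<Sum>i\<in>UNIV. f (Inl i, Inr j)))" for k
    using f(3) edge_flow_bip_edges[where k = k, OF off] sum_incidence[of "\<lambda>i j. f (Inl i, Inr j)" k] by simp
  show thesis
  proof
    show "0 \<le> f (Inl i, Inr j)" for i j using f(1) by blast
    show "f (Inl i, Inr j) = 0" if "(i, j) \<notin> G" for i j
      using off that by (simp add: Inl_Inr_mem_bip_edges)
  qed (simp_all add: z)
qed

text \<open>The edge vectors satisfy the cut inequalities, which cut out a convex set. Conversely
  the flow of \<open>x\<close> consists of convex coefficients, because its total is the left sum
  \<open>1\<close>.\<close>

lemma mem_root_polytope_iff:
  fixes G :: "('m::finite \<times> 'n::finite) set"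
  shows "x \<in> root_polytope G \<longleftrightarrow>
    vec_nth x \<in> cut_cone (bip_edges G) UNIV \<and> sum (vec_nth x) (range Inl) = 1"
proof
  let ?C = "{x. vec_nth x \<in> cut_cone (bip_edges G) UNIV \<and> sum (vec_nth x) (range Inl) = 1}"
  have "root_polytope G \<subseteq> ?C"
    unfolding root_polytope_def
  proof (rule hull_minimal)
    show "{axis (Inl i) 1 - axis (Inr j) 1 | i j. (i, j) \<in> G} \<subseteq> ?C"
    proof clarify
      fix i j assume "(i, j) \<in> G"
      have "sum (vec_nth (axis (Inl i) 1 - axis (Inr j) 1 :: real ^ ('m + 'n))) S =
          of_bool (Inl i \<in> S) - of_bool (Inr j \<in> S)" for S
      proof -
        have "vec_nth (axis (Inl i) 1 - axis (Inr j) 1 :: real ^ ('m + 'n)) =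
            (\<lambda>k. of_bool (k = Inl i) - of_bool (k = Inr j))"
          by (auto simp: fun_eq_iff axis_def)
        then show ?thesis by (simp add: sum_subtractf of_bool_def)
      qed
      then show "vec_nth (axis (Inl i) 1 - axis (Inr j) 1) \<in> cut_cone (bip_edges G) UNIV \<and>
          sum (vec_nth (axis (Inl i) 1 - axis (Inr j) 1 :: real ^ ('m + 'n))) (range Inl) = 1"
        using \<open>(i, j) \<in> G\<close> by (auto simp: cut_cone_def up_closed_bip_edges)
    qed
    show "convex ?C"
    proof (rule convexI)
      fix x y :: "real ^ ('m + 'n)" and u v :: real
      assume xy: "x \<in> ?C" "y \<in> ?C" and uv: "0 \<le> u" "0 \<le> v" "u + v = 1"
      have "sum (vec_nth (u *\<^sub>R x + v *\<^sub>R y)) S = u * sum (vec_nth x) S + v * sum (vec_nth y) S" for S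
        by (simp add: sum.distrib sum_distrib_left)
      then show "u *\<^sub>R x + v *\<^sub>R y \<in> ?C" using xy uv by (simp add: cut_cone_def)
    qed
  qed
  then show "vec_nth x \<in> cut_cone (bip_edges G) UNIV \<and> sum (vec_nth x) (range Inl) = 1"
    if "x \<in> root_polytope G" using that by blast
next
  assume x: "vec_nth x \<in> cut_cone (bip_edges G) UNIV \<and> sum (vec_nth x) (range Inl) = 1"
  then obtain f where f: "\<And>i j. 0 \<le> f i j" "\<And>i j. (i, j) \<notin> G \<Longrightarrow> f i j = 0"
    "\<And>i. x $ Inl i = (\<Sum>j\<in>UNIV. f i j)" "\<And>j. x $ Inr j = - (\<Sum>i\<in>UNIV. f i j)"
    using cut_cone_bip_flow by blast
  have eq: "(\<Sum>(i, j)\<in>UNIV. h i j) = (\<Sum>(i, j)\<in>G. h i j)"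
    if "\<And>i j. (i, j) \<notin> G \<Longrightarrow> h i j = 0" for h :: "'m \<Rightarrow> 'n \<Rightarrow> 'b::comm_monoid_add"
    using that by (intro sum.mono_neutral_right) auto
  have "(\<Sum>(i, j)\<in>G. f i j) = (\<Sum>i\<in>UNIV. x $ Inl i)"
    by (simp add: eq[symmetric] f sum.cartesian_product)
  also have "\<dots> = 1" using x by (simp add: sum.reindex)
  finally have f1: "(\<Sum>e\<in>G. f (fst e) (snd e)) = 1" by (simp add: split_beta')
  have "x = (\<Sum>e\<in>G. f (fst e) (snd e) *\<^sub>R (axis (Inl (fst e)) 1 - axis (Inr (snd e)) 1))" (is "x = ?r")
  proof -
    have "?r $ k = x $ k" for k
    proof -
      have "?r $ k = (\<Sum>(i, j)\<in>G. f i j * (of_bool (k = Inl i) - of_bool (k = Inr j)))"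
        unfolding sum_component split_beta'
        by (intro sum.cong) (auto simp: axis_def)
      also have "\<dots> = (\<Sum>i\<in>UNIV. \<Sum>j\<in>UNIV. f i j * (of_bool (k = Inl i) - of_bool (k = Inr j)))"
        by (subst eq[symmetric]) (simp_all add: f sum.cartesian_product)
      also have "\<dots> = x $ k" unfolding sum_incidence using f(3,4) by (cases k) simp_all
      finally show ?thesis .
    qed
    then show ?thesis by (simp add: vec_eq_iff)
  qed
  moreover have "?r \<in> root_polytope G"
    unfolding root_polytope_def
  proof (rule convex_sum[OF _ _ f1])
    fix e assume "e \<in> G"
    show "axis (Inl (fst e)) 1 - axis (Inr (snd e)) 1 \<in>
        convex hull {axis (Inl i) 1 - axis (Inr j) 1 | i j. (i, j) \<in> G}"
      by (rule hull_inc, rule CollectI, rule exI[of _ "fst e"], rule exI[of _ "snd e"])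
         (use \<open>e \<in> G\<close> in simp)
  qed (simp_all add: f(1))
  ultimately show "x \<in> root_polytope G" by metis
qed

section \<open>Generalized permutohedra and their trimmed lattice points\<close>

lemma mem_coord_simplex_iff:
  fixes y :: "real ^ 'n::finite"
  shows "y \<in> coord_simplex N \<longleftrightarrow>
    (\<forall>j. 0 \<le> y $ j) \<and> (\<forall>j. j \<notin> N \<longrightarrow> y $ j = 0) \<and> (\<Sum>j\<in>UNIV. y $ j) = 1"
proof
  let ?C = "{y :: real ^ 'n. (\<forall>j. 0 \<le> y $ j) \<and> (\<forall>j. j \<notin> N \<longrightarrow> y $ j = 0) \<and> (\<Sum>j\<in>UNIV. y $ j) = 1}"
  have "coord_simplex N \<subseteq> ?C"
    unfolding coord_simplex_def
  proof (rule hull_minimal)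
    show "(\<lambda>j. axis j 1) ` N \<subseteq> ?C" by (auto simp: axis_def)
    show "convex ?C"
      by (auto simp: convex_def sum.distrib simp flip: sum_distrib_left)
  qed
  then show "(\<forall>j. 0 \<le> y $ j) \<and> (\<forall>j. j \<notin> N \<longrightarrow> y $ j = 0) \<and> (\<Sum>j\<in>UNIV. y $ j) = 1"
    if "y \<in> coord_simplex N" using that by blast
next
  assume y: "(\<forall>j. 0 \<le> y $ j) \<and> (\<forall>j. j \<notin> N \<longrightarrow> y $ j = 0) \<and> (\<Sum>j\<in>UNIV. y $ j) = 1"
  have "(\<Sum>j\<in>N. y $ j) = (\<Sum>j\<in>UNIV. y $ j)"
    using y by (intro sum.mono_neutral_left) auto
  moreover have "y = (\<Sum>j\<in>N. y $ j *\<^sub>R axis j 1)"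
    using y by (auto simp: vec_eq_iff axis_def if_distrib cong: if_cong)
  moreover have "(\<Sum>j\<in>N. y $ j *\<^sub>R axis j 1) \<in> coord_simplex N" if "(\<Sum>j\<in>N. y $ j) = 1"
    unfolding coord_simplex_def using y that by (intro convex_sum) (auto intro: hull_inc)
  ultimately show "y \<in> coord_simplex N" using y by metis
qed

definition left_ones :: "real ^ 'n \<Rightarrow> 'm + 'n \<Rightarrow> real" where
  "left_ones x = case_sum (\<lambda>_. 1) (\<lambda>j. - (x $ j))"

text \<open>Cayley trick: the permutohedron is the slice of the same cone where all left coordinates
  are \<open>1\<close>. The rows of a flow are the Minkowski summands. Conversely, a left vertex
  outside an up-closed set has no neighbours in it, so each summand contributes nonnegatively to the
  cut.\<close>

lemma mem_gen_permutohedron_iff: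
  fixes G :: "('m::finite \<times> 'n::finite) set"
  shows "x \<in> gen_permutohedron G \<longleftrightarrow> left_ones x \<in> cut_cone (bip_edges G) UNIV"
proof
  assume "x \<in> gen_permutohedron G"
  then obtain s where s: "x = (\<Sum>i\<in>UNIV. s i)" "\<And>i. s i \<in> coord_simplex (nbrs G i)"
    unfolding gen_permutohedron_def by (auto simp: set_sum_alt)
  have eq: "sum (left_ones x) S = (\<Sum>i\<in>UNIV. of_bool (Inl i \<in> S) - (\<Sum>j\<in>UNIV. of_bool (Inr j \<in> S) * s i $ j))"
    for S :: "('m + 'n) set"
  proof -
    have "(\<Sum>j\<in>UNIV. of_bool (Inr j \<in> S) * left_ones x (Inr j :: 'm + 'n)) =
        - (\<Sum>j\<in>UNIV. \<Sum>i\<in>UNIV. of_bool (Inr j \<in> S) * s i $ j)"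
      by (simp add: left_ones_def s(1) sum_negf sum_distrib_left)
    also have "\<dots> = - (\<Sum>i\<in>UNIV. \<Sum>j\<in>UNIV. of_bool (Inr j \<in> S) * s i $ j)"
      by (simp only: sum.swap[of _ _ "UNIV :: 'n set"])
    finally show ?thesis by (simp add: sum_Plus sum_subtractf left_ones_def)
  qed
  show "left_ones x \<in> cut_cone (bip_edges G) UNIV"
    unfolding cut_cone_def mem_Collect_eq eq
  proof (intro conjI allI impI sum_nonneg)
    show "(\<Sum>i\<in>UNIV. of_bool (Inl i \<in> (UNIV :: ('m + 'n) set)) -
        (\<Sum>j\<in>UNIV. of_bool (Inr j \<in> (UNIV :: ('m + 'n) set)) * s i $ j)) = 0"
      using s(2) by (simp add: mem_coord_simplex_iff)
    fix S :: "('m + 'n) set" and i assume S: "up_closed (bip_edges G) UNIV S"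
    have si: "0 \<le> s i $ j" "j \<notin> nbrs G i \<Longrightarrow> s i $ j = 0" "(\<Sum>j\<in>UNIV. s i $ j) = 1" for j
      using s(2)[of i] by (auto simp: mem_coord_simplex_iff)
    show "0 \<le> of_bool (Inl i \<in> S) - (\<Sum>j\<in>UNIV. of_bool (Inr j \<in> S) * s i $ j)"
    proof (cases "Inl i \<in> S")
      case True
      have "(\<Sum>j\<in>UNIV. of_bool (Inr j \<in> S) * s i $ j) \<le> (\<Sum>j\<in>UNIV. s i $ j)"
        using si by (intro sum_mono) auto
      then show ?thesis using True si by simp
    next
      case False
      have "of_bool (Inr j \<in> S) * s i $ j = 0" for j
        using False S si(2)[of j] by (auto simp: up_closed_bip_edges nbrs_def)
      then show ?thesis by simp
    qed
  qed
next
  assume "left_ones x \<in> cut_cone (bip_edges G) UNIV"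
  then obtain f where f: "\<And>i j. 0 \<le> f i j" "\<And>i j. (i, j) \<notin> G \<Longrightarrow> f i j = 0"
    "\<And>i. left_ones x (Inl i :: 'm + 'n) = (\<Sum>j\<in>UNIV. f i j)"
    "\<And>j. left_ones x (Inr j :: 'm + 'n) = - (\<Sum>i\<in>UNIV. f i j)"
    using cut_cone_bip_flow by blast
  define s where "s i = (\<chi> j. f i j)" for i
  have "s i \<in> coord_simplex (nbrs G i)" for i
    using f by (auto simp: mem_coord_simplex_iff s_def nbrs_def left_ones_def)
  moreover have "x = (\<Sum>i\<in>UNIV. s i)"
    using f(4) by (simp add: vec_eq_iff s_def left_ones_def)
  ultimately show "x \<in> gen_permutohedron G"
    unfolding gen_permutohedron_def by (auto simp: set_sum_alt)
qed

text \<open>The permutohedron is convex, so containing a translated simplex amounts to containing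
  its vertices.\<close>

lemma mem_trimmed_permutohedron_iff:
  "x \<in> trimmed_permutohedron G \<longleftrightarrow> (\<forall>j. x + axis j 1 \<in> gen_permutohedron G)"
proof -
  have "convex (gen_permutohedron G)"
    unfolding gen_permutohedron_def coord_simplex_def by (intro convex_set_sum) auto
  then have conv: "convex {d. x + d \<in> gen_permutohedron G}"
  proof (intro convexI CollectI)
    fix d e and u v :: real
    assume "d \<in> {d. x + d \<in> gen_permutohedron G}" "e \<in> {d. x + d \<in> gen_permutohedron G}"
      and uv: "0 \<le> u" "0 \<le> v" "u + v = 1"
    then have "u *\<^sub>R (x + d) + v *\<^sub>R (x + e) \<in> gen_permutohedron G"
      using \<open>convex (gen_permutohedron G)\<close> by (auto simp: convex_def)
    moreover have "u *\<^sub>R (x + d) + v *\<^sub>R (x + e) = (u + v) *\<^sub>R x + (u *\<^sub>R d + v *\<^sub>R e)"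
      by (simp add: scaleR_add_right scaleR_add_left)
    ultimately show "x + (u *\<^sub>R d + v *\<^sub>R e) \<in> gen_permutohedron G" using uv by simp
  qed
  have "x \<in> trimmed_permutohedron G \<longleftrightarrow> coord_simplex UNIV \<subseteq> {d. x + d \<in> gen_permutohedron G}"
    by (auto simp: trimmed_permutohedron_def elt_set_plus_def)
  also have "\<dots> \<longleftrightarrow> (\<forall>j. x + axis j 1 \<in> gen_permutohedron G)"
    unfolding coord_simplex_def subset_hull[of convex, OF conv] by auto
  finally show ?thesis .
qed

text \<open>Adding the vertex \<open>axis j 1\<close> lowers the sum over each cut containing
  \<open>Inr j\<close> by \<open>1\<close>. Hence trimming raises the bound \<open>0\<close> of the
  permutohedron to the bound \<open>1\<close> of draconian sequences.\<close>

lemma card_lattice_points_trimmed: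
  fixes G :: "('m::finite \<times> 'n::finite) set"
  shows "card (lattice_points (trimmed_permutohedron G)) =
    card (draconian (range Inl) (bip_edges G) UNIV)"
proof -
  define \<Psi> :: "('m + 'n \<Rightarrow> int) \<Rightarrow> real ^ 'n" where "\<Psi> w = (\<chi> j. - of_int (w (Inr j)))" for w
  have mem: "\<Psi> w \<in> trimmed_permutohedron G \<longleftrightarrow> w \<in> draconian (range Inl) (bip_edges G) UNIV"
    if w: "\<And>i. w (Inl i) = 1" for w
  proof -
    have sums: "sum (left_ones (\<Psi> w + axis j 1)) S = of_int (sum w S) - of_bool (Inr j \<in> S)"
      for j and S :: "('m + 'n) set"
    proof -
      have "left_ones (\<Psi> w + axis j 1) = (\<lambda>k. of_int (w k) - of_bool (k = Inr j))"
        by (auto simp: fun_eq_iff left_ones_def \<Psi>_def axis_def w split: sum.splits)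
      then show ?thesis by (simp add: sum_subtractf of_bool_def)
    qed
    have "\<Psi> w \<in> trimmed_permutohedron G \<longleftrightarrow> sum w UNIV = 1 \<and>
        (\<forall>S. up_closed (bip_edges G) UNIV S \<longrightarrow> (\<forall>j. of_bool (Inr j \<in> S) \<le> sum w S))"
    proof -
      have "real_of_int (sum w UNIV) - 1 = 0 \<longleftrightarrow> sum w UNIV = 1"
        "0 \<le> real_of_int (sum w S) - of_bool b \<longleftrightarrow> of_bool b \<le> sum w S" for S b
        by (auto simp: of_bool_def simp del: of_int_sum)
      then show ?thesis
        unfolding mem_trimmed_permutohedron_iff mem_gen_permutohedron_iff cut_cone_def mem_Collect_eq sums
        by auto
    qed
    also have "\<dots> \<longleftrightarrow> w \<in> draconian (range Inl) (bip_edges G) UNIV"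
    proof -
      have "(\<forall>j. of_bool (Inr j \<in> S) \<le> sum w S) \<longleftrightarrow> (S \<noteq> {} \<longrightarrow> 1 \<le> sum w S)" for S
      proof (cases "\<exists>j. Inr j \<in> S")
        case True
        then show ?thesis by (force simp: of_bool_def)
      next
        case False
        \<comment> \<open>A cut of left vertices only has sum equal to its size, so the bound is
          automatic.\<close>
        then have "w k = 1" if "k \<in> S" for k using that w by (cases k) auto
        then have "sum w S = int (card S)" by simp
        moreover have "S \<noteq> {} \<Longrightarrow> 1 \<le> card S"
          by (simp add: Suc_le_eq card_gt_0_iff)
        ultimately show ?thesis using False by auto
      qed
      then show ?thesis using w by (auto simp: draconian_def)
    qed
    finally show ?thesis .
  qed
  have one: "w (Inl i) = 1" if "w \<in> draconian (range Inl) (bip_edges G) UNIV" for w i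
    using that by (auto simp: draconian_def)
  have "inj_on \<Psi> (draconian (range Inl) (bip_edges G) UNIV)"
  proof (rule inj_onI)
    fix w w' assume w: "w \<in> draconian (range Inl) (bip_edges G) UNIV"
      "w' \<in> draconian (range Inl) (bip_edges G) UNIV" and "\<Psi> w = \<Psi> w'"
    then have "w (Inr j) = w' (Inr j)" for j by (auto simp: \<Psi>_def vec_eq_iff)
    then have "w k = w' k" for k using one[OF w(1)] one[OF w(2)] by (cases k) auto
    then show "w = w'" by auto
  qed
  moreover have "\<Psi> ` draconian (range Inl) (bip_edges G) UNIV = lattice_points (trimmed_permutohedron G)"
  proof (intro set_eqI iffI)
    fix x assume "x \<in> \<Psi> ` draconian (range Inl) (bip_edges G) UNIV"
    then show "x \<in> lattice_points (trimmed_permutohedron G)"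
      using mem one by (auto simp: lattice_points_def \<Psi>_def)
  next
    fix x assume x: "x \<in> lattice_points (trimmed_permutohedron G)"
    define w where "w = case_sum (\<lambda>_ :: 'm. 1) (\<lambda>j. - \<lfloor>x $ j\<rfloor>)"
    have "x = \<Psi> w" using x by (auto simp: \<Psi>_def w_def lattice_points_def vec_eq_iff)
    moreover have "w (Inl i) = 1" for i by (simp add: w_def)
    ultimately show "x \<in> \<Psi> ` draconian (range Inl) (bip_edges G) UNIV"
      using x mem[of w] by (auto simp: lattice_points_def)
  qed
  ultimately show ?thesis by (metis card_image)
qed

subsection \<open>Normalized volume as a mass\<close>

text \<open>One vertex is omitted on each side, since the sums on both sides are prescribed.\<close>

definition root_coords :: "'m \<Rightarrow> 'n \<Rightarrow> ('m + 'n) set" where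
  "root_coords i0 j0 = UNIV - {Inl i0, Inr j0}"

definition root_gen :: "'m \<Rightarrow> 'n \<Rightarrow> 'm + 'n \<Rightarrow> real ^ ('m::finite + 'n::finite)" where
  "root_gen i0 j0 k = axis k 1 - axis (case k of Inl _ \<Rightarrow> Inl i0 | Inr _ \<Rightarrow> Inr j0) 1"

text \<open>The free coordinates are \<open>c\<close>, the left sum is \<open>s\<close> and the
  right sum \<open>- s\<close>. Using \<open>bal\<close> makes it agree with the chart of
  \<open>cone_mass\<close> after a shift of the coordinate \<open>Inl i0\<close>.\<close>

definition root_point :: "'m \<Rightarrow> 'n \<Rightarrow> real \<Rightarrow> ('m + 'n \<Rightarrow> real) \<Rightarrow> 'm + 'n \<Rightarrow> real" where
  "root_point i0 j0 s c =
     bal (Inr j0) UNIV (c(Inl i0 := s - sum c (root_coords i0 j0 \<inter> range Inl)))"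

lemma mem_root_coords: "l \<in> root_coords i0 j0 \<longleftrightarrow> l \<noteq> Inl i0 \<and> l \<noteq> Inr j0"
  by (simp add: root_coords_def)

lemma lincomb_root_gen:
  "lincomb (root_coords i0 j0) (root_gen i0 j0) c $ l =
    (if l \<in> root_coords i0 j0 then c l
     else if l = Inl i0 then - sum c (root_coords i0 j0 \<inter> range Inl)
     else - sum c (root_coords i0 j0 - range Inl))"
proof -
  let ?K = "root_coords i0 j0"
  let ?r = "\<lambda>k. case k of Inl _ \<Rightarrow> Inl i0 | Inr _ \<Rightarrow> Inr j0"
  have "lincomb ?K (root_gen i0 j0) c $ l = (\<Sum>k\<in>?K. c k * of_bool (k = l)) - (\<Sum>k\<in>?K. c k * of_bool (?r k = l))"
    by (simp add: lincomb_def root_gen_def axis_def of_bool_def sum_subtractf algebra_simps eq_commute[of l])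
  moreover have "(\<Sum>k\<in>?K. c k * of_bool (k = l)) = (if l \<in> ?K then c l else 0)"
    by (simp add: of_bool_def if_distrib[of "(*) _"] cong: if_cong)
  moreover have "(\<Sum>k\<in>?K. c k * of_bool (?r k = l)) = sum c {k \<in> ?K. ?r k = l}"
    by (rule sum.mono_neutral_cong_right) auto
  moreover have "{k \<in> ?K. ?r k = l} = (if l \<in> ?K then {} else if l = Inl i0 then ?K \<inter> range Inl else ?K - range Inl)"
  proof (rule set_eqI)
    fix k
    show "k \<in> {k \<in> ?K. ?r k = l} \<longleftrightarrow>
        k \<in> (if l \<in> ?K then {} else if l = Inl i0 then ?K \<inter> range Inl else ?K - range Inl)"
      by (cases k; cases l) (auto simp: mem_root_coords)
  qed
  ultimately show ?thesis by simp
qed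

lemma root_point_apply:
  fixes i0 :: "'m::finite" and j0 :: "'n::finite"
  shows "root_point i0 j0 s c l =
    (if l \<in> root_coords i0 j0 then c l
     else if l = Inl i0 then s - sum c (root_coords i0 j0 \<inter> range Inl)
     else - s - sum c (root_coords i0 j0 - range Inl))"
proof -
  let ?K = "root_coords i0 j0"
  have "UNIV - {Inr j0} = insert (Inl i0) ?K" "Inl i0 \<notin> ?K" by (auto simp: root_coords_def)
  then have "sum (c(Inl i0 := y)) (UNIV - {Inr j0}) = y + sum c ?K" for y
    using sum_fun_upd[of "insert (Inl i0) ?K" c "Inl i0" y] by simp
  moreover have "sum c ?K = sum c (?K \<inter> range Inl) + sum c (?K - range Inl)"
    by (rule sum.Int_Diff) simp
  ultimately show ?thesis by (auto simp: root_point_def bal_def mem_root_coords)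
qed

lemma sum_root_point:
  fixes i0 :: "'m::finite" and j0 :: "'n::finite"
  shows "sum (root_point i0 j0 s c) (range Inl) = s"
proof -
  have "range Inl = insert (Inl i0) (root_coords i0 j0 \<inter> range Inl)" "Inl i0 \<notin> root_coords i0 j0"
    by (auto simp: root_coords_def)
  moreover have "sum (root_point i0 j0 s c) (root_coords i0 j0 \<inter> range Inl) =
      sum c (root_coords i0 j0 \<inter> range Inl)"
    by (rule sum.cong) (simp_all add: root_point_apply)
  ultimately show ?thesis
    using root_point_apply[of i0 j0 s c "Inl i0"] by (metis (no_types, lifting) IntD1 add.commute
        diff_add_cancel finite_code sum.insert)
qed

lemma root_point_scale:
  fixes i0 :: "'m::finite" and j0 :: "'n::finite"
  shows "root_point i0 j0 s (\<lambda>k\<in>root_coords i0 j0. s * c k) = (\<lambda>l. s * root_point i0 j0 1 c l)"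
  by (auto simp: fun_eq_iff root_point_apply sum_distrib_left algebra_simps)

lemma root_polytope_coords:
  fixes G :: "('m::finite \<times> 'n::finite) set"
  shows "axis (Inl i0) 1 - axis (Inr j0) 1 + lincomb (root_coords i0 j0) (root_gen i0 j0) c \<in> root_polytope G
    \<longleftrightarrow> root_point i0 j0 1 c \<in> cut_cone (bip_edges G) UNIV"
proof -
  have "vec_nth (axis (Inl i0) 1 - axis (Inr j0) 1 + lincomb (root_coords i0 j0) (root_gen i0 j0) c) =
      root_point i0 j0 1 c"
    by (auto simp: fun_eq_iff root_point_apply lincomb_root_gen axis_def mem_root_coords)
  then show ?thesis by (simp add: mem_root_polytope_iff sum_root_point)
qed

lemma lincomb_root_gen_expand:
  fixes x :: "real ^ ('m::finite + 'n::finite)"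
  assumes "(\<Sum>i\<in>UNIV. x $ Inl i) = 0" "(\<Sum>j\<in>UNIV. x $ Inr j) = 0"
  shows "x = lincomb (root_coords i0 j0) (root_gen i0 j0) (vec_nth x)"
proof -
  let ?K = "root_coords i0 j0"
  have ins: "range Inl = insert (Inl i0) (?K \<inter> range Inl)" "range Inr = insert (Inr j0) (?K - range Inl)"
    "Inl i0 \<notin> ?K" "Inr j0 \<notin> ?K"
  proof -
    show "range Inl = insert (Inl i0) (?K \<inter> range Inl)" by (auto simp: mem_root_coords)
    have "k \<in> range Inr \<longleftrightarrow> k \<in> insert (Inr j0) (?K - range Inl)" for k
      by (cases k) (auto simp: mem_root_coords)
    then show "range Inr = insert (Inr j0) (?K - range Inl)" by (rule set_eqI)
  qed (simp_all add: mem_root_coords)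
  have "sum (vec_nth x) (range Inl) = 0" "sum (vec_nth x) (range Inr) = 0"
    using assms by (simp_all add: sum.reindex)
  moreover have "sum (vec_nth x) (insert (Inl i0) (?K \<inter> range Inl)) =
      x $ Inl i0 + sum (vec_nth x) (?K \<inter> range Inl)"
    "sum (vec_nth x) (insert (Inr j0) (?K - range Inl)) =
      x $ Inr j0 + sum (vec_nth x) (?K - range Inl)"
    using ins(3,4) by (simp_all del: range_eqI)
  ultimately have "x $ Inl i0 = - sum (vec_nth x) (?K \<inter> range Inl)"
    "x $ Inr j0 = - sum (vec_nth x) (?K - range Inl)"
    using ins(1,2) by (metis eq_neg_iff_add_eq_0)+
  then show ?thesis
    by (auto simp: vec_eq_iff lincomb_root_gen mem_root_coords)
qed

text \<open>An integer vector whose left and right sums vanish is determined by its coordinates in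
  \<open>root_coords\<close>, and these are its coefficients.\<close>

lemma lattice_family_root_gen:
  fixes i0 :: "'m::finite" and j0 :: "'n::finite"
  shows "lattice_family root_lattice (root_coords i0 j0) (root_gen i0 j0)"
proof -
  let ?K = "root_coords i0 j0"
  let ?g = "lincomb ?K (root_gen i0 j0)"
  have "c k = 0" if "?g c = 0" "k \<in> ?K" for c k
    using lincomb_root_gen[of i0 j0 c k] that by simp
  moreover have "?g (\<lambda>k. of_int (c k)) \<in> root_lattice" for c :: "'m + 'n \<Rightarrow> int"
  proof -
    have gen: "(\<Sum>i\<in>UNIV. root_gen i0 j0 k $ Inl i) = 0" "(\<Sum>j\<in>UNIV. root_gen i0 j0 k $ Inr j) = 0" for k
      by (auto simp: root_gen_def sum_subtractf sum_axis image_iff split: sum.splits)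
    have "(\<Sum>i\<in>UNIV. ?g d $ Inl i) = 0" "(\<Sum>j\<in>UNIV. ?g d $ Inr j) = 0" for d
      unfolding lincomb_def sum_component
      by (subst sum.swap, simp add: gen flip: sum_distrib_left)+
    moreover have "?g (\<lambda>k. of_int (c k)) $ l \<in> \<int>" for l
      by (auto simp: lincomb_root_gen)
    ultimately show ?thesis by (simp add: root_lattice_def)
  qed
  moreover have "\<exists>c. x = ?g (\<lambda>k. of_int (c k))" if x: "x \<in> root_lattice" for x
  proof -
    have "x = ?g (vec_nth x)"
      using x by (intro lincomb_root_gen_expand) (simp_all add: root_lattice_def)
    also have "\<dots> = ?g (\<lambda>k. of_int \<lfloor>x $ k\<rfloor>)"
      using x by (intro lincomb_cong) (simp add: root_lattice_def)
    finally show ?thesis by (rule exI[of _ "\<lambda>k. \<lfloor>x $ k\<rfloor>"])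
  qed
  ultimately show ?thesis by (auto simp: lattice_family_def)
qed

lemma root_volume_root_polytope:
  fixes G :: "('m::finite \<times> 'n::finite) set"
  shows "root_volume (root_polytope G) =
    enn2real (\<integral>\<^sup>+c. indicator (cut_cone (bip_edges G) UNIV) (root_point i0 j0 1 c) \<partial>lborel_on (root_coords i0 j0))"
proof -
  let ?K = "root_coords i0 j0"
  define p :: "real ^ ('m + 'n)" where "p = (SOME p. p \<in> root_subspace)"
  define B :: "(real ^ ('m + 'n)) set" where "B = (SOME B. lattice_basis root_lattice B)"
  define q :: "real ^ ('m + 'n)" where "q = axis (Inl i0) 1 - axis (Inr j0) 1"
  have p: "p \<in> root_subspace" unfolding p_def by (rule someI_ex) (rule root_subspace_nonempty)
  have B: "lattice_basis root_lattice B" unfolding B_def by (rule someI_ex) (rule lattice_basis_exists)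
  have q: "q \<in> root_subspace" by (simp add: q_def root_subspace_def sum_subtractf sum_axis image_iff)
  \<comment> \<open>The chosen origin differs from the convenient one by a vector of the span, so it
    may be replaced.\<close>
  have "p - q = lincomb ?K (root_gen i0 j0) (vec_nth (p - q))"
    using p q by (intro lincomb_root_gen_expand) (simp_all add: root_subspace_def sum_subtractf)
  then have pq: "p = q + lincomb ?K (root_gen i0 j0) (vec_nth (p - q))" by (metis add.commute diff_add_cancel)
  have "compact (root_polytope G)"
    unfolding root_polytope_def
  proof (rule finite_imp_compact_convex_hull)
    have "{axis (Inl i) 1 - axis (Inr j) 1 | i j. (i, j) \<in> G} =
        (\<lambda>(i, j). axis (Inl i) 1 - axis (Inr j) 1 :: real ^ ('m + 'n)) ` G" by auto
    then show "finite {axis (Inl i) 1 - axis (Inr j) 1 :: real ^ ('m + 'n) | i j. (i, j) \<in> G}" by simp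
  qed
  then have meas: "root_polytope G \<in> sets borel" by (intro borel_closed compact_imp_closed)
  have "root_volume (root_polytope G) = coord_volume p B (root_polytope G)"
    by (simp add: root_volume_def p_def B_def)
  also have "\<dots> = enn2real (\<integral>\<^sup>+c. indicator (root_polytope G) (q + lincomb ?K (root_gen i0 j0) c) \<partial>lborel_on ?K)"
    by (subst pq) (rule coord_volume_eq_nn_integral[OF B lattice_family_root_gen meas])
  finally show ?thesis
    unfolding q_def indicator_def by (simp only: root_polytope_coords)
qed

section \<open>Slicing the cone by the sum of the left coordinates\<close>

lemma fact_ennreal: "(fact n :: ennreal) = ennreal (fact n)"
  by (metis ennreal_of_nat_eq_real_of_nat of_nat_fact)

text \<open>Euler's integral for Gamma at \<open>d + 1\<close>; the source of the factorial.\<close>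

lemma nn_integral_power_exp:
  "(\<integral>\<^sup>+s. indicator {0<..} s * ennreal (s ^ d * exp (- s)) \<partial>lborel) = fact d"
proof -
  have "indicator {0<..} s * ennreal (s ^ d * exp (- s)) =
      ennreal (indicator {0..} s * s powr (real d + 1 - 1) / exp s)" for s :: real
    by (cases "s > 0") (auto simp: indicator_def powr_realpow exp_minus field_simps)
  moreover have "Gamma (real d + 1) = fact d" using Gamma_fact[of d, where 'a = real] by (simp add: add.commute)
  ultimately show ?thesis
    using Gamma_conv_nn_integral_real[of "real d + 1"] by (simp add: fact_ennreal)
qed

text \<open>The cone is sliced by the value \<open>s\<close> of the sum of the left coordinates.\<close>
lemma cone_mass_eq_fact_mult:
  fixes G :: "('m::finite \<times> 'n::finite) set"
  shows "cone_mass (range Inl) (bip_edges G) UNIV (Inr j0) = fact (card (root_coords i0 j0)) *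
    (\<integral>\<^sup>+c. indicator (cut_cone (bip_edges G) UNIV) (root_point i0 j0 1 c) \<partial>lborel_on (root_coords i0 j0))"
proof -
  let ?K = "root_coords i0 j0" and ?C = "cut_cone (bip_edges G) UNIV"
  let ?D = "\<lambda>z. cone_density (range Inl) (bip_edges G) UNIV (bal (Inr j0) UNIV z)"
  let ?P = "root_point i0 j0"
  have K: "finite ?K" "Inl i0 \<notin> ?K" "UNIV - {Inr j0} = insert (Inl i0) ?K"
    by (auto simp: root_coords_def)
  have D: "?D \<in> borel_measurable (lborel_on (insert (Inl i0) ?K))"
    using measurable_cone_density[of "UNIV :: ('m + 'n) set" "Inr j0"] by (simp add: K(3))
  define f where "f s c = indicator ?C (?P s c) * ennreal (exp (- s))" for s c
  have f: "?D (c(Inl i0 := s - sum c (?K \<inter> range Inl))) = f s c" for s c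
    using sum_root_point[of i0 j0 s c] by (simp add: f_def cone_density_def root_point_def)
  have joint: "(\<lambda>(c, s). f s c) \<in> borel_measurable (lborel_on ?K \<Otimes>\<^sub>M lborel)"
  proof -
    have [measurable]: "(\<lambda>c. sum c (?K \<inter> range Inl)) \<in> borel_measurable (lborel_on ?K)"
      by (rule measurable_sum_lborel_on) auto
    have "(\<lambda>(c, s). c(Inl i0 := s - sum c (?K \<inter> range Inl)))
        \<in> lborel_on ?K \<Otimes>\<^sub>M lborel \<rightarrow>\<^sub>M lborel_on (insert (Inl i0) ?K)"
      unfolding split_beta' by (rule measurable_fun_upd[where J = ?K]) auto
    from measurable_compose[OF this D] show ?thesis by (simp add: split_beta' f)
  qed
  interpret KL: pair_sigma_finite "lborel_on ?K" "lborel :: real measure"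
    by (intro pair_sigma_finite.intro lborel_product.sigma_finite K sigma_finite_lborel)
  \<comment> \<open>With \<open>c\<close> fixed, passing from the coordinate \<open>Inl i0\<close>
    to the left sum \<open>s\<close> is a translation.\<close>
  have inner: "(\<integral>\<^sup>+y. ?D (c(Inl i0 := y)) \<partial>lborel) = (\<integral>\<^sup>+s. f s c \<partial>lborel)"
    if c: "c \<in> space (lborel_on ?K)" for c
  proof -
    have "(\<lambda>y. ?D (c(Inl i0 := y))) \<in> borel_measurable lborel"
      by (rule measurable_compose[OF measurable_component_update[OF c K(2)] D])
    then have "(\<lambda>y. ?D (c(Inl i0 := y))) \<in> borel_measurable borel" by (simp only: measurable_lborel2)
    note nn_integral_real_affine[OF this, of 1 "- sum c (?K \<inter> range Inl)"]
    moreover have "- sum c (?K \<inter> range Inl) + 1 * s = s - sum c (?K \<inter> range Inl)" for s by simp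
    ultimately show ?thesis by (simp only: f abs_one ennreal_1 mult_1_left zero_neq_one not_False_eq_True)
  qed
  have fs: "f s \<in> borel_measurable (lborel_on ?K)" for s
    using measurable_compose[OF _ joint, of "\<lambda>c. (c, s)" "lborel_on ?K"] by simp
  have ind: "(\<lambda>c. indicator ?C (?P 1 c) :: ennreal) \<in> borel_measurable (lborel_on ?K)"
  proof -
    have "indicator ?C (?P 1 c) = f 1 c * ennreal (exp 1)" for c
      by (simp add: f_def mult.assoc flip: ennreal_mult exp_add)
    then show ?thesis using fs[of 1] by simp
  qed
  \<comment> \<open>For \<open>s > 0\<close> dilation by \<open>s\<close> gives the slice at
    \<open>1\<close> with the factor \<open>s ^ card ?K\<close>; for \<open>s < 0\<close> the slice
    is empty, as \<open>range Inl\<close> is up-closed. The value \<open>s = 0\<close> is a null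
    set.\<close>
  have slice: "(\<integral>\<^sup>+c. f s c \<partial>lborel_on ?K) = indicator {0<..} s * ennreal (s ^ card ?K * exp (- s)) *
      (\<integral>\<^sup>+c. indicator ?C (?P 1 c) \<partial>lborel_on ?K)" if "s \<noteq> 0" for s
  proof (cases "0 < s")
    case True
    have "(\<lambda>l. s * z l) \<in> ?C \<longleftrightarrow> z \<in> ?C" for z
      using True by (simp add: cut_cone_def zero_le_mult_iff flip: sum_distrib_left)
    then have "f s (\<lambda>k\<in>?K. 0 + s * c k) = indicator ?C (?P 1 c) * ennreal (exp (- s))" for c
      unfolding f_def add_0 root_point_scale by (simp add: indicator_def)
    then have "(\<integral>\<^sup>+c. f s c \<partial>lborel_on ?K) = ennreal (s ^ card ?K) *
        (\<integral>\<^sup>+c. indicator ?C (?P 1 c) * ennreal (exp (- s)) \<partial>lborel_on ?K)"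
      using nn_integral_lborel_on_affine[OF K(1) that fs[of s], of "\<lambda>_. 0"] True by simp
    also have "(\<integral>\<^sup>+c. indicator ?C (?P 1 c) * ennreal (exp (- s)) \<partial>lborel_on ?K) =
        (\<integral>\<^sup>+c. indicator ?C (?P 1 c) \<partial>lborel_on ?K) * ennreal (exp (- s))"
      by (rule nn_integral_multc) (rule ind)
    finally show ?thesis using True by (simp add: ennreal_mult ac_simps)
  next
    case False
    have "?P s c \<notin> ?C" for c
    proof
      assume "?P s c \<in> ?C"
      moreover have "up_closed (bip_edges G) UNIV (range Inl)"
        by (auto simp: up_closed_bip_edges)
      ultimately have "0 \<le> sum (?P s c) (range Inl)" by (simp add: cut_cone_def)
      then show False using False that by (simp add: sum_root_point)
    qed
    then show ?thesis using False by (simp add: f_def)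
  qed
  have "cone_mass (range Inl) (bip_edges G) UNIV (Inr j0) = (\<integral>\<^sup>+c. \<integral>\<^sup>+y. ?D (c(Inl i0 := y)) \<partial>lborel \<partial>lborel_on ?K)"
    unfolding cone_mass_def K(3) by (rule lborel_product.product_nn_integral_insert[OF K(1,2) D])
  also have "\<dots> = (\<integral>\<^sup>+c. \<integral>\<^sup>+s. f s c \<partial>lborel \<partial>lborel_on ?K)"
    by (rule nn_integral_cong) (rule inner)
  also have "\<dots> = (\<integral>\<^sup>+s. \<integral>\<^sup>+c. f s c \<partial>lborel_on ?K \<partial>lborel)"
    by (rule KL.Fubini'[symmetric]) (rule joint)
  also have "\<dots> = (\<integral>\<^sup>+s. indicator {0<..} s * ennreal (s ^ card ?K * exp (- s)) *
      (\<integral>\<^sup>+c. indicator ?C (?P 1 c) \<partial>lborel_on ?K) \<partial>lborel)"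
  proof (rule nn_integral_cong_AE)
    show "AE s in lborel. (\<integral>\<^sup>+c. f s c \<partial>lborel_on ?K) = indicator {0<..} s *
        ennreal (s ^ card ?K * exp (- s)) * (\<integral>\<^sup>+c. indicator ?C (?P 1 c) \<partial>lborel_on ?K)"
      using AE_lborel_singleton[of "0::real"] by eventually_elim (rule slice)
  qed
  also have "\<dots> = fact (card ?K) * (\<integral>\<^sup>+c. indicator ?C (?P 1 c) \<partial>lborel_on ?K)"
    by (subst nn_integral_multc) (simp_all add: nn_integral_power_exp)
  finally show ?thesis .
qed

theorem theorem12p2:
  fixes G :: "('m::finite \<times> 'n::finite) set"
  assumes "connected_bipartite G"
  shows "root_volume (root_polytope G) =
    real (card (lattice_points (trimmed_permutohedron G))) / fact (CARD('m) + CARD('n) - 2)"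
proof -
  \<comment> \<open>Any vertex on each side can be the eliminated one; the index types are
    nonempty.\<close>
  define i0 :: 'm where "i0 = undefined"
  define j0 :: 'n where "j0 = undefined"
  let ?V = "\<integral>\<^sup>+c. indicator (cut_cone (bip_edges G) UNIV) (root_point i0 j0 1 c) \<partial>lborel_on (root_coords i0 j0)"
  \<comment> \<open>The two omitted vertices are distinct, so the subtraction is not
    truncated.\<close>
  have "card (root_coords i0 j0) = CARD('m + 'n) - 2"
    by (simp add: root_coords_def card_Diff_subset)
  then have card: "card (root_coords i0 j0) = CARD('m) + CARD('n) - 2" by simp
  have "fact (CARD('m) + CARD('n) - 2) * ?V = of_nat (card (draconian (range Inl) (bip_edges G) UNIV))"
    using cone_mass_eq_card_draconian[OF _ bip_edges_subset[of G], of UNIV "Inr j0"]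
      cone_mass_eq_fact_mult[of G j0 i0] by (simp add: card)
  from arg_cong[OF this, of enn2real]
  have "fact (CARD('m) + CARD('n) - 2) * enn2real ?V =
      real (card (draconian (range Inl) (bip_edges G) UNIV))"
    by (simp add: enn2real_mult ennreal_of_nat_eq_real_of_nat fact_ennreal)
  then show ?thesis
    unfolding root_volume_root_polytope[of G i0 j0] card_lattice_points_trimmed
    by (simp add: field_simps)
qed

end
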